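(* Let $\Lambda$ be a locally-convex, row-finite $k$-graph, $R$ a commutative ring with $1$, and $J\subseteq KP_R(\Lambda)$ a basic graded ideal. Then (i) $J^\perp=I(\Lambda^0\setminus\overline{H}(J))$; (ii) $J^{\perp\perp}=I(\{w\in\Lambda^0: T(w)\subseteq\overline{H}(J)\})$; (iii) $J$ is regular if and only if $H(J)=\{w\in\Lambda^0: T(w)\subseteq\overline{H}(J)\}$.
   Context: A $k$-graph $(\Lambda,d)$ is a countable category with a functor $d:\Lambda\to\mathbb{N}^k$ with unique factorization ($d(\lambda)=m+n$ gives unique $\lambda=\mu\nu$, $d(\mu)=m,d(\nu)=n$); vertices $\Lambda^0$ are degree-$0$ paths, $r,s$ range and source, $e_i$ standard generators. Row-finite: finitely many paths of each degree with each range. $\Lambda^{\le n}=\{\lambda:d(\lambda)\le n,\ d(\lambda)_i<n_i\Rightarrow s(\lambda)\Lambda^{e_i}=\emptyset\}$. Locally-convex: for $i\ne j$, $\lambda\in v\Lambda^{e_i}$, $\mu\in v\Lambda^{e_j}$, $s(\lambda)\Lambda^{e_j}\ne\emptyset\ne s(\mu)\Lambda^{e_i}$. $KP_R(\Lambda)$ is the universal $R$-algebra generated by $p_v$, $s_\lambda,s_{\lambda^*}$ with relations (KP1) $p_v$ mutually orthogonal idempotents; (KP2) $s_\lambda s_\mu=s_{\lambda\mu}$, $s_{\mu^*}s_{\lambda^*}=s_{(\lambda\mu)^*}$, $p_{r(\lambda)}s_\lambda=s_\lambda=s_\lambda p_{s(\lambda)}$, $p_{s(\lambda)}s_{\lambda^*}=s_{\lambda^*}=s_{\lambda^*}p_{r(\lambda)}$;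 (KP3) $s_{\lambda^*}s_\mu=\delta_{\lambda,\mu}p_{s(\lambda)}$ for $\lambda,\mu\in\Lambda^{\le n}$, $n\ne0$; (KP4) $p_v=\sum_{\lambda\in v\Lambda^{\le n}}s_\lambda s_{\lambda^*}$, $n\ne0$. It is $\mathbb{Z}^k$-graded by $KP_R(\Lambda)_n=\mathrm{span}\{s_\alpha s_{\beta^*}:d(\alpha)-d(\beta)=n\}$; an ideal is graded if it contains the homogeneous components of its elements; basic if $rp_v\in I$, $r\ne0$ imply $p_v\in I$. For an ideal $I$: $H(I)=\{v:p_v\in I\}$, $\overline{H}(I)=\{r(\lambda): s(\lambda)\in H(I)\}$, $I^\perp=\{a:ax=xa=0\ \forall x\in I\}$; $I$ is regular if $I^{\perp\perp}=I$. For $H\subseteq\Lambda^0$, $I(H)$ is the ideal generated by $\{p_v:v\in H\}$. For $w\in\Lambda^0$, $T(w)=\{s(\lambda):\lambda\in\Lambda,\ r(\lambda)=w\}$. *)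

theory Defs
  imports Main "HOL-Library.Countable_Set"
begin

text \<open>A k-graph is represented set-theoretically: a carrier set of paths (morphisms),
range and source maps (returning identity morphisms, which represent the objects),
a composition (cmp l m = "l m", defined when src l = rng m), and a degree functor
into N^k, where elements of N^k are functions nat => nat vanishing at indices >= k.\<close>

record 'a kgraph =
  paths :: "'a set"
  rng :: "'a \<Rightarrow> 'a"
  src :: "'a \<Rightarrow> 'a"
  cmp :: "'a \<Rightarrow> 'a \<Rightarrow> 'a"
  deg :: "'a \<Rightarrow> nat \<Rightarrow> nat"

definition in_Nk :: "nat \<Rightarrow> (nat \<Rightarrow> nat) \<Rightarrow> bool" where
  "in_Nk k n \<longleftrightarrow> (\<forall>i\<ge>k. n i = 0)"

definition dadd :: "(nat \<Rightarrow> nat) \<Rightarrow> (nat \<Rightarrow> nat) \<Rightarrow> nat \<Rightarrow> nat" where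
  "dadd m n = (\<lambda>i. m i + n i)"

definition ebasis :: "nat \<Rightarrow> nat \<Rightarrow> nat" where
  "ebasis i = (\<lambda>j. if j = i then 1 else 0)"

definition is_kgraph :: "nat \<Rightarrow> 'a kgraph \<Rightarrow> bool" where
  "is_kgraph k G \<longleftrightarrow>
     countable (paths G) \<and>
     (\<forall>l\<in>paths G. rng G l \<in> paths G \<and> src G l \<in> paths G \<and>
        rng G (rng G l) = rng G l \<and> src G (rng G l) = rng G l \<and>
        rng G (src G l) = src G l \<and> src G (src G l) = src G l \<and>
        cmp G (rng G l) l = l \<and> cmp G l (src G l) = l \<and>
        deg G (rng G l) = (\<lambda>_. 0) \<and> deg G (src G l) = (\<lambda>_. 0) \<and>
        in_Nk k (deg G l)) \<and>
     (\<forall>l\<in>paths G. \<forall>m\<in>paths G. src G l = rng G m \<longrightarrow>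
        cmp G l m \<in> paths G \<and> rng G (cmp G l m) = rng G l \<and>
        src G (cmp G l m) = src G m \<and> deg G (cmp G l m) = dadd (deg G l) (deg G m)) \<and>
     (\<forall>l\<in>paths G. \<forall>m\<in>paths G. \<forall>n\<in>paths G. src G l = rng G m \<longrightarrow> src G m = rng G n \<longrightarrow>
        cmp G (cmp G l m) n = cmp G l (cmp G m n)) \<and>
     (\<forall>l\<in>paths G. \<forall>m n. in_Nk k m \<longrightarrow> in_Nk k n \<longrightarrow> deg G l = dadd m n \<longrightarrow>
        (\<exists>!p. fst p \<in> paths G \<and> snd p \<in> paths G \<and> src G (fst p) = rng G (snd p) \<and>
              deg G (fst p) = m \<and> deg G (snd p) = n \<and> l = cmp G (fst p) (snd p)))"

definition verts :: "'a kgraph \<Rightarrow> 'a set" where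
  "verts G = {v\<in>paths G. deg G v = (\<lambda>_. 0)}"

definition row_finite :: "'a kgraph \<Rightarrow> bool" where
  "row_finite G \<longleftrightarrow> (\<forall>v\<in>verts G. \<forall>n. finite {l\<in>paths G. rng G l = v \<and> deg G l = n})"

definition locally_convex :: "nat \<Rightarrow> 'a kgraph \<Rightarrow> bool" where
  "locally_convex k G \<longleftrightarrow>
     (\<forall>i<k. \<forall>j<k. i \<noteq> j \<longrightarrow> (\<forall>v\<in>verts G. \<forall>l\<in>paths G. \<forall>m\<in>paths G.
        rng G l = v \<longrightarrow> rng G m = v \<longrightarrow> deg G l = ebasis i \<longrightarrow> deg G m = ebasis j \<longrightarrow>
        (\<exists>a\<in>paths G. rng G a = src G l \<and> deg G a = ebasis j) \<and>
        (\<exists>b\<in>paths G. rng G b = src G m \<and> deg G b = ebasis i)))"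

definition le_paths :: "nat \<Rightarrow> 'a kgraph \<Rightarrow> (nat \<Rightarrow> nat) \<Rightarrow> 'a set" where
  "le_paths k G n = {l\<in>paths G. deg G l \<le> n \<and>
     (\<forall>i<k. deg G l i < n i \<longrightarrow> \<not>(\<exists>m\<in>paths G. rng G m = src G l \<and> deg G m = ebasis i))}"

datatype 'a gen = Pg 'a | Sg 'a | Tg 'a  (* p_v, s_lambda, s_{lambda^*} *)

type_synonym ('a, 'r) fa = "'a gen list \<Rightarrow> 'r"

text \<open>Elements of the free non-unital R-algebra: finitely supported R-valued functions on
nonempty words in the generators.\<close>
definition FA :: "('a, 'r::comm_ring_1) fa set" where
  "FA = {f. finite {w. f w \<noteq> 0} \<and> f [] = 0}"

definition fzero :: "('a, 'r::comm_ring_1) fa" where "fzero = (\<lambda>_. 0)"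
definition fadd :: "('a, 'r::comm_ring_1) fa \<Rightarrow> ('a, 'r) fa \<Rightarrow> ('a, 'r) fa" where
  "fadd f g = (\<lambda>w. f w + g w)"
definition fsub :: "('a, 'r::comm_ring_1) fa \<Rightarrow> ('a, 'r) fa \<Rightarrow> ('a, 'r) fa" where
  "fsub f g = (\<lambda>w. f w - g w)"
definition fscale :: "'r::comm_ring_1 \<Rightarrow> ('a, 'r) fa \<Rightarrow> ('a, 'r) fa" where
  "fscale c f = (\<lambda>w. c * f w)"
definition fmul :: "('a, 'r::comm_ring_1) fa \<Rightarrow> ('a, 'r) fa \<Rightarrow> ('a, 'r) fa" where
  "fmul f g = (\<lambda>w. \<Sum>i\<le>length w. f (take i w) * g (drop i w))"
definition fsum :: "('b \<Rightarrow> ('a, 'r::comm_ring_1) fa) \<Rightarrow> 'b set \<Rightarrow> ('a, 'r) fa" where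
  "fsum F A = (\<lambda>w. \<Sum>x\<in>A. F x w)"
definition mono :: "'a gen \<Rightarrow> ('a, 'r::comm_ring_1) fa" where
  "mono x = (\<lambda>w. if w = [x] then 1 else 0)"

definition pp :: "'a \<Rightarrow> ('a, 'r::comm_ring_1) fa" where "pp v = mono (Pg v)"
definition sp :: "'a \<Rightarrow> ('a, 'r::comm_ring_1) fa" where "sp l = mono (Sg l)"
definition sps :: "'a \<Rightarrow> ('a, 'r::comm_ring_1) fa" where "sps l = mono (Tg l)"

definition is_ideal :: "('a, 'r::comm_ring_1) fa set \<Rightarrow> bool" where
  "is_ideal I \<longleftrightarrow> I \<subseteq> FA \<and> fzero \<in> I \<and> (\<forall>x\<in>I. \<forall>y\<in>I. fadd x y \<in> I) \<and>
     (\<forall>c. \<forall>x\<in>I. fscale c x \<in> I) \<and> (\<forall>a\<in>FA. \<forall>x\<in>I. fmul a x \<in> I \<and> fmul x a \<in> I)"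

definition gen_ideal :: "('a, 'r::comm_ring_1) fa set \<Rightarrow> ('a, 'r) fa set" where
  "gen_ideal X = \<Inter>{I. is_ideal I \<and> X \<subseteq> I}"

definition fspan :: "('a, 'r::comm_ring_1) fa set \<Rightarrow> ('a, 'r) fa set" where
  "fspan X = {fsum (\<lambda>x. fscale (c x) x) A | A c. finite A \<and> A \<subseteq> X}"

text \<open>The defining relations (KP1)-(KP4) of KP_R(Lambda), together with the conventions
s_v = s_{v^*} = p_v for vertices v and the vanishing of generators indexed by elements that
are not vertices/paths.  KP_R(Lambda) is FA modulo the ideal generated by these.\<close>
definition KPrel :: "nat \<Rightarrow> 'a kgraph \<Rightarrow> ('a, 'r::comm_ring_1) fa set" where
  "KPrel k G =
     {pp v | v. v \<notin> verts G} \<union> {sp x | x. x \<notin> paths G} \<union> {sps x | x. x \<notin> paths G} \<union>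
     {fsub (sp v) (pp v) | v. v \<in> verts G} \<union> {fsub (sps v) (pp v) | v. v \<in> verts G} \<union>
     \<comment> \<open>(KP1)\<close>
     {fsub (fmul (pp v) (pp w)) (if v = w then pp v else fzero) | v w. v \<in> verts G \<and> w \<in> verts G} \<union>
     \<comment> \<open>(KP2)\<close>
     {fsub (fmul (sp l) (sp m)) (sp (cmp G l m)) | l m. l \<in> paths G \<and> m \<in> paths G \<and> src G l = rng G m} \<union>
     {fsub (fmul (sps m) (sps l)) (sps (cmp G l m)) | l m. l \<in> paths G \<and> m \<in> paths G \<and> src G l = rng G m} \<union>
     {fsub (fmul (pp (rng G l)) (sp l)) (sp l) | l. l \<in> paths G} \<union>
     {fsub (fmul (sp l) (pp (src G l))) (sp l) | l. l \<in> paths G} \<union>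
     {fsub (fmul (pp (src G l)) (sps l)) (sps l) | l. l \<in> paths G} \<union>
     {fsub (fmul (sps l) (pp (rng G l))) (sps l) | l. l \<in> paths G} \<union>
     \<comment> \<open>(KP3)\<close>
     {fsub (fmul (sps l) (sp m)) (if l = m then pp (src G l) else fzero) | l m n.
        in_Nk k n \<and> n \<noteq> (\<lambda>_. 0) \<and> l \<in> le_paths k G n \<and> m \<in> le_paths k G n} \<union>
     \<comment> \<open>(KP4)\<close>
     {fsub (pp v) (fsum (\<lambda>l. fmul (sp l) (sps l)) {l \<in> le_paths k G n. rng G l = v}) | v n.
        v \<in> verts G \<and> in_Nk k n \<and> n \<noteq> (\<lambda>_. 0)}"

text \<open>The kernel of FA -> KP_R(Lambda).  Ideals of KP_R(Lambda) correspond bijectively to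
ideals of FA containing KPker (via preimage); we work with these preimages throughout.\<close>
definition KPker :: "nat \<Rightarrow> 'a kgraph \<Rightarrow> ('a, 'r::comm_ring_1) fa set" where
  "KPker k G = gen_ideal (KPrel k G)"

definition kp_ideal :: "nat \<Rightarrow> 'a kgraph \<Rightarrow> ('a, 'r::comm_ring_1) fa set \<Rightarrow> bool" where
  "kp_ideal k G J \<longleftrightarrow> is_ideal J \<and> KPker k G \<subseteq> J"

definition KPhom :: "nat \<Rightarrow> 'a kgraph \<Rightarrow> (nat \<Rightarrow> int) \<Rightarrow> ('a, 'r::comm_ring_1) fa set" where
  "KPhom k G n = {f \<in> FA. \<exists>g \<in> fspan {fmul (sp a) (sps b) | a b. a \<in> paths G \<and> b \<in> paths G \<and>
        (\<lambda>i. int (deg G a i) - int (deg G b i)) = n}. fsub f g \<in> KPker k G}"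

definition graded_ideal :: "nat \<Rightarrow> 'a kgraph \<Rightarrow> ('a, 'r::comm_ring_1) fa set \<Rightarrow> bool" where
  "graded_ideal k G J \<longleftrightarrow>
     (\<forall>a\<in>J. \<forall>N c. finite N \<and> (\<forall>n\<in>N. c n \<in> KPhom k G n) \<and> fsub a (fsum c N) \<in> KPker k G
        \<longrightarrow> (\<forall>n\<in>N. c n \<in> J))"

definition basic_ideal :: "'a kgraph \<Rightarrow> ('a, 'r::comm_ring_1) fa set \<Rightarrow> bool" where
  "basic_ideal G J \<longleftrightarrow> (\<forall>(c::'r) v. v \<in> verts G \<and> c \<noteq> 0 \<and> fscale c (pp v) \<in> J \<longrightarrow> pp v \<in> J)"

definition ann :: "nat \<Rightarrow> 'a kgraph \<Rightarrow> ('a, 'r::comm_ring_1) fa set \<Rightarrow> ('a, 'r) fa set" where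
  "ann k G J = {a \<in> FA. \<forall>x\<in>J. fmul a x \<in> KPker k G \<and> fmul x a \<in> KPker k G}"

definition Igen :: "nat \<Rightarrow> 'a kgraph \<Rightarrow> 'a set \<Rightarrow> ('a, 'r::comm_ring_1) fa set" where
  "Igen k G H = gen_ideal (KPker k G \<union> {pp v | v. v \<in> H})"

definition Hset :: "'a kgraph \<Rightarrow> ('a, 'r::comm_ring_1) fa set \<Rightarrow> 'a set" where
  "Hset G J = {v \<in> verts G. pp v \<in> J}"

definition Hbar :: "'a kgraph \<Rightarrow> ('a, 'r::comm_ring_1) fa set \<Rightarrow> 'a set" where
  "Hbar G J = {rng G l | l. l \<in> paths G \<and> src G l \<in> Hset G J}"

definition Tset :: "'a kgraph \<Rightarrow> 'a \<Rightarrow> 'a set" where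
  "Tset G w = {src G l | l. l \<in> paths G \<and> rng G l = w}"

end

(* Modulo the defining relations every homogeneous element of degree n is a finite combination of
   S a * T b with a in LE m and b in LE m', m - m' = n (expand by (KP4)); the elements S a * T b are
   then matrix units, so each coefficient c(a,b) can be read off as T a * x * S b = c(a,b) P (src a).
   Applied to a basic graded ideal J this gives J = I(H(J)). Applied to x in the annihilator of J,
   if c(a,b) is nonzero and src a is the range of a path l with src l in H(J), then
   c(a,b) P (src l) lies both in J and in its annihilator, hence vanishes; this is excluded by the
   action of the algebra on functions on the boundary path space, where c P v acts as zero only for
   c = 0 (the only place where local convexity enters). So the annihilator is I(V - Hbar(J)), again a
   basic graded ideal, and taking annihilators twice yields the remaining claims. *)
theory Submission
  imports Defs "HOL-Library.Function_Algebras"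
begin

text \<open>Reading off coefficients is possible only if all first paths of the terms lie in one set
  \<open>LE m\<close> and all second paths in one set \<open>LE m'\<close>, since (KP3) compares
  members of the same set. Homogeneity provides this: replacing \<open>S a * T b\<close> by the sum
  of all \<open>S (cmp G a c) * T (cmp G b c)\<close> keeps the difference of degrees, so all terms
  of degree n reach the same pair of bounds. Hence everything is reduced to homogeneous elements,
  and the annihilator, not graded by its definition, is the obstacle. Words carry degrees and the
  relations are homogeneous, so components can be taken in the free algebra. Local convexity makes
  prepending a path to a boundary path produce a boundary path: a member of a larger
  \<open>LE n'\<close>, cut at \<open>n\<close>, must lie in \<open>LE n\<close>. For the second
  annihilator, a vertex w lies outside Hbar of the first one exactly if no path with range w has its
  source outside Hbar(J), that is, if T(w) is contained in Hbar(J). For (iii), J and its double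
  annihilator are both generated by the vertices they contain, so they agree exactly if these
  vertices do.\<close>

section \<open>The unital free algebra\<close>

text \<open>A unit is adjoined to \<open>FA\<close> so that the algebra becomes an instance of \<open>ring_1\<close>. Elements of
  \<open>FA\<close> are those whose coefficient at the empty word vanishes, and ideals of \<open>FA\<close> are also ideals
  of the larger algebra.\<close>

typedef (overloaded) ('a, 'r::comm_ring_1) falg =
  "{f :: 'a gen list \<Rightarrow> 'r. finite {w. f w \<noteq> 0}}"
  morphisms coef Falg
  by (rule exI[of _ "\<lambda>_. 0"]) simp

setup_lifting type_definition_falg

lemma finite_supp [simp]: "finite {w. coef x w \<noteq> 0}"
  using coef[of x] by simp

lemma finite_supp_Un:
  assumes "finite {w. f w \<noteq> 0}" and "finite {w. g w \<noteq> 0}"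
    and "\<And>w. f w = 0 \<Longrightarrow> g w = 0 \<Longrightarrow> h w = 0"
  shows "finite {w. h w \<noteq> 0}"
  using finite_UnI[OF assms(1,2)] by (rule rev_finite_subset) (use assms(3) in blast)

lemma finite_supp_fmul:
  assumes "finite {w. f w \<noteq> 0}" and "finite {w. g w \<noteq> 0}"
  shows "finite {w. fmul f g w \<noteq> 0}"
proof (rule finite_subset)
  show "{w. fmul f g w \<noteq> 0} \<subseteq> (\<lambda>(u, v). u @ v) ` ({w. f w \<noteq> 0} \<times> {w. g w \<noteq> 0})"
  proof
    fix w assume "w \<in> {w. fmul f g w \<noteq> 0}"
    then obtain i where "f (take i w) * g (drop i w) \<noteq> 0"
      unfolding fmul_def by (metis (mono_tags, lifting) mem_Collect_eq sum.neutral)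
    then have "f (take i w) \<noteq> 0" "g (drop i w) \<noteq> 0" by auto
    then have "(take i w, drop i w) \<in> {w. f w \<noteq> 0} \<times> {w. g w \<noteq> 0}" by simp
    then show "w \<in> (\<lambda>(u, v). u @ v) ` ({w. f w \<noteq> 0} \<times> {w. g w \<noteq> 0})"
      by (rule rev_image_eqI) simp
  qed
qed (use assms in simp)

lemma fmul_assoc:
  fixes f g h :: "('a, 'r::comm_ring_1) fa"
  shows "fmul (fmul f g) h = fmul f (fmul g h)"
proof
  fix w :: "'a gen list"
  let ?n = "length w"
  let ?t = "\<lambda>a b. f (take a w) * g (take b (drop a w)) * h (drop (a + b) w)"
  have "fmul (fmul f g) h w = (\<Sum>i\<le>?n. \<Sum>j\<le>i. ?t j (i - j))"
    unfolding fmul_def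
    by (auto simp: sum_distrib_right min_def drop_take intro!: sum.cong)
  \<comment> \<open>The cut points \<open>j \<le> i\<close> are reindexed by the lengths
    \<open>j\<close> and \<open>i - j\<close> of the first two factors.\<close>
  also have "\<dots> = (\<Sum>j\<le>?n. \<Sum>i\<le>?n - j. ?t j i)"
    unfolding sum.triangle_reindex_eq[symmetric, of ?t] by (subst sum.Sigma) (auto intro!: sum.cong)
  also have "\<dots> = fmul f (fmul g h) w"
    unfolding fmul_def
    by (auto simp: sum_distrib_left mult.assoc add.commute intro!: sum.cong)
  finally show "fmul (fmul f g) h w = fmul f (fmul g h) w" .
qed

instantiation falg :: (type, comm_ring_1) ring_1
begin
lift_definition zero_falg :: "('a, 'b) falg" is fzero by (simp add: fzero_def)
lift_definition one_falg :: "('a, 'b) falg" is "\<lambda>w. if w = [] then 1 else 0" by simp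
lift_definition plus_falg :: "('a, 'b) falg \<Rightarrow> ('a, 'b) falg \<Rightarrow> ('a, 'b) falg" is fadd
  by (erule (1) finite_supp_Un) (simp add: fadd_def)
lift_definition minus_falg :: "('a, 'b) falg \<Rightarrow> ('a, 'b) falg \<Rightarrow> ('a, 'b) falg" is fsub
  by (erule (1) finite_supp_Un) (simp add: fsub_def)
lift_definition uminus_falg :: "('a, 'b) falg \<Rightarrow> ('a, 'b) falg" is "\<lambda>f w. - f w" by simp
lift_definition times_falg :: "('a, 'b) falg \<Rightarrow> ('a, 'b) falg \<Rightarrow> ('a, 'b) falg" is fmul
  by (rule finite_supp_fmul)
instance
proof
  fix a b c :: "('a, 'b) falg"
  show "a + b + c = a + (b + c)" by transfer (simp add: fadd_def add.assoc)
  show "a + b = b + a" by transfer (simp add: fadd_def add.commute)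
  show "0 + a = a" by transfer (simp add: fadd_def fzero_def)
  show "- a + a = 0" by transfer (simp add: fadd_def fzero_def)
  show "a - b = a + - b" by transfer (simp add: fadd_def fsub_def)
  show "a * b * c = a * (b * c)" by transfer (rule fmul_assoc)
  show "(a + b) * c = a * c + b * c"
    by transfer (simp add: fadd_def fmul_def distrib_right sum.distrib)
  show "a * (b + c) = a * b + a * c"
    by transfer (simp add: fadd_def fmul_def distrib_left sum.distrib)
  show "1 * a = a"
  proof (transfer, rule ext)
    fix a :: "'a gen list \<Rightarrow> 'b" and w
    have "fmul (\<lambda>w. if w = [] then 1 else 0) a w = (\<Sum>i\<in>{0}. a (drop i w))"
      unfolding fmul_def by (rule sum.mono_neutral_cong_right) auto
    then show "fmul (\<lambda>w. if w = [] then 1 else 0) a w = a w" by simp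
  qed
  show "a * 1 = a"
  proof (transfer, rule ext)
    fix a :: "'a gen list \<Rightarrow> 'b" and w
    have "fmul a (\<lambda>w. if w = [] then 1 else 0) w = (\<Sum>i\<in>{length w}. a (take i w))"
      unfolding fmul_def by (rule sum.mono_neutral_cong_right) auto
    then show "fmul a (\<lambda>w. if w = [] then 1 else 0) w = a w" by simp
  qed
  show "(0::('a, 'b) falg) \<noteq> 1" by transfer (auto simp: fzero_def fun_eq_iff)
qed
end

lift_definition scl :: "'r::comm_ring_1 \<Rightarrow> ('a, 'r) falg \<Rightarrow> ('a, 'r) falg" is fscale
  by (rule finite_subset) (auto simp: fscale_def)

lift_definition mon :: "'a gen list \<Rightarrow> ('a, 'r::comm_ring_1) falg" is "\<lambda>u w. if w = u then 1 else 0"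
  by simp

lemma scl_simps [simp]:
  "scl c x * y = scl c (x * y)" "x * scl c y = scl c (x * y)" "scl c (scl d x) = scl (c * d) x"
  "scl 1 x = x" "scl 0 x = 0" "scl c 0 = 0"
  by (transfer, simp add: fscale_def fmul_def fzero_def sum_distrib_left algebra_simps)+

lemma scl_add: "scl c (x + y) = scl c x + scl c y"
  by transfer (simp add: fscale_def fadd_def algebra_simps)
lemma scl_add_left: "scl (c + d) x = scl c x + scl d x"
  by transfer (simp add: fscale_def fadd_def algebra_simps)
lemma scl_diff: "scl c (x - y) = scl c x - scl c y"
  by transfer (simp add: fscale_def fsub_def algebra_simps)
lemma scl_sum: "scl c (sum f A) = (\<Sum>i\<in>A. scl c (f i))"
  by (induction A rule: infinite_finite_induct) (auto simp: scl_add)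

lemma coef_sum: "coef (sum f A) = fsum (\<lambda>i. coef (f i)) A"
  by (induction A rule: infinite_finite_induct)
     (auto simp: fsum_def zero_falg.rep_eq fzero_def plus_falg.rep_eq fadd_def)

lemma mon_Nil: "mon [] = 1" by transfer simp

lemma mon_append: "mon (u @ v) = (mon u * mon v :: ('a, 'r::comm_ring_1) falg)"
proof (transfer, rule ext)
  fix u v w :: "'a gen list"
  have "take i w = u \<and> drop i w = v \<longleftrightarrow> w = u @ v \<and> i = length u" if "i \<le> length w" for i
    using that by auto
  then have *: "(if take i w = u then 1 else 0) * (if drop i w = v then 1 else 0)
      = (if i = length u then if w = u @ v then 1 else 0 else (0::'r))" if "i \<le> length w" for i
    using that by (cases "take i w = u"; cases "drop i w = v") (simp_all, auto)
  have "fmul (\<lambda>w. if w = u then 1 else 0) (\<lambda>w. if w = v then 1 else 0) w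
      = (\<Sum>i\<le>length w. if i = length u then if w = u @ v then 1 else 0 else (0::'r))"
    unfolding fmul_def by (intro sum.cong refl *) simp
  then show "(if w = u @ v then 1 else (0::'r)) =
     fmul (\<lambda>w. if w = u then 1 else 0) (\<lambda>w. if w = v then 1 else 0) w"
    by simp
qed

lemma falg_expand: "x = (\<Sum>w\<in>{w. coef x w \<noteq> 0}. scl (coef x w) (mon w))"
proof (rule coef_inject[THEN iffD1], rule ext)
  fix u
  show "coef x u = coef (\<Sum>w\<in>{w. coef x w \<noteq> 0}. scl (coef x w) (mon w)) u"
    by (simp add: coef_sum fsum_def scl.rep_eq fscale_def mon.rep_eq if_distrib sum.delta cong: if_cong)
qed

text \<open>Reduces linear claims to single words, whose products are concatenations by
  \<open>mon_append\<close>.\<close>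

lemma falg_induct [case_names zero add]:
  assumes "P 0" and "\<And>c w x. P x \<Longrightarrow> P (scl c (mon w) + x)"
  shows "P x"
proof -
  have "P (\<Sum>w\<in>A. scl (c w) (mon w))" if "finite A" for A and c :: "'a gen list \<Rightarrow> 'b"
    using that by (induction A) (auto intro: assms)
  from this[of "{w. coef x w \<noteq> 0}" "coef x"] show ?thesis
    by (simp flip: falg_expand)
qed

text \<open>The linear functional extending \<open>\<phi>\<close>. The action on functions is later
  defined by such functionals, one for each function and each point.\<close>

definition lin :: "('a gen list \<Rightarrow> 'r) \<Rightarrow> ('a, 'r::comm_ring_1) falg \<Rightarrow> 'r" where
  "lin \<phi> x = (\<Sum>w\<in>{w. coef x w \<noteq> 0}. coef x w * \<phi> w)"

lemma lin_superset:
  "finite A \<Longrightarrow> {w. coef x w \<noteq> 0} \<subseteq> A \<Longrightarrow> lin \<phi> x = (\<Sum>w\<in>A. coef x w * \<phi> w)"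
  unfolding lin_def by (rule sum.mono_neutral_left) auto

lemma lin_add: "lin \<phi> (x + y) = lin \<phi> x + lin \<phi> y"
proof -
  let ?A = "{w. coef x w \<noteq> 0} \<union> {w. coef y w \<noteq> 0}"
  have "lin \<phi> z = (\<Sum>w\<in>?A. coef z w * \<phi> w)" if "z \<in> {x, y, x + y}" for z
    using that by (intro lin_superset) (auto simp: plus_falg.rep_eq fadd_def)
  then show ?thesis
    by (simp add: plus_falg.rep_eq fadd_def distrib_right sum.distrib)
qed

lemma lin_scl: "lin \<phi> (scl c x) = c * lin \<phi> x"
proof -
  have "lin \<phi> (scl c x) = (\<Sum>w\<in>{w. coef x w \<noteq> 0}. coef (scl c x) w * \<phi> w)"
    by (rule lin_superset) (auto simp: scl.rep_eq fscale_def)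
  then show ?thesis
    by (simp add: scl.rep_eq fscale_def lin_def sum_distrib_left mult.assoc)
qed

lemma lin_mon: "lin \<phi> (mon w) = \<phi> w"
  by (simp add: lin_def mon.rep_eq)

lemma lin_0: "lin \<phi> 0 = 0"
  by (simp add: lin_def zero_falg.rep_eq fzero_def)

lemma lin_diff: "lin \<phi> (x - y) = lin \<phi> x - lin \<phi> y"
  by (metis add_diff_cancel_right' diff_add_cancel lin_add)

lemma lin_sum: "lin \<phi> (sum f A) = (\<Sum>i\<in>A. lin \<phi> (f i))"
  by (induction A rule: infinite_finite_induct) (auto simp: lin_add lin_0)

lemma lin_mon_mult: "lin \<phi> (mon u * x) = lin (\<lambda>w. \<phi> (u @ w)) x"
proof (induction x rule: falg_induct)
  case (add c w x)
  then show ?case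
    by (simp add: distrib_left lin_add)
       (simp add: lin_scl lin_mon flip: mon_append)
qed (simp add: lin_0)

lemma lin_mult_mon: "lin \<phi> (x * mon u) = lin (\<lambda>w. \<phi> (w @ u)) x"
proof (induction x rule: falg_induct)
  case (add c w x)
  then show ?case
    by (simp add: distrib_right lin_add)
       (simp add: lin_scl lin_mon flip: mon_append)
qed (simp add: lin_0)

section \<open>Ideals with and without the adjoined unit\<close>

definition uideal :: "('a, 'r::comm_ring_1) falg set \<Rightarrow> bool" where
  "uideal I \<longleftrightarrow> 0 \<in> I \<and> (\<forall>x\<in>I. \<forall>y\<in>I. x + y \<in> I) \<and> (\<forall>c. \<forall>x\<in>I. scl c x \<in> I) \<and>
     (\<forall>a. \<forall>x\<in>I. a * x \<in> I \<and> x * a \<in> I)"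

text \<open>Transport along the injection \<open>coef\<close>; on subsets of \<open>FA\<close>
  nothing is lost (\<open>up_inject\<close>), so equalities of ideals can be proved in the ring and
  pulled back.\<close>

definition up :: "('a, 'r::comm_ring_1) fa set \<Rightarrow> ('a, 'r) falg set" where
  "up I = {x. coef x \<in> I}"

lemma FA_iff: "coef x \<in> FA \<longleftrightarrow> coef x [] = 0"
  by (simp add: FA_def)

lemma FA_coefE:
  assumes "f \<in> FA" obtains x where "f = coef x" "coef x [] = 0"
  using assms that[of "Falg f"] Falg_inverse[of f] unfolding FA_def by auto

lemma up_inject: "A \<subseteq> FA \<Longrightarrow> B \<subseteq> FA \<Longrightarrow> up A = up B \<Longrightarrow> A = B"
  unfolding up_def set_eq_iff mem_Collect_eq by (metis FA_coefE subsetD)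

lemma coef_split:
  obtains y where "x = scl (coef x []) 1 + y" "coef y [] = 0"
  by (rule that[of "x - scl (coef x []) 1"])
     (simp_all add: minus_falg.rep_eq fsub_def scl.rep_eq fscale_def one_falg.rep_eq)

text \<open>Multipliers may now have a constant term. Once it is split off, it acts by
  \<open>scl\<close>, and the rest belongs to \<open>FA\<close>.\<close>

lemma uideal_up:
  assumes "is_ideal I" shows "uideal (up I)"
proof -
  have I: "fzero \<in> I" "\<And>x y. x \<in> I \<Longrightarrow> y \<in> I \<Longrightarrow> fadd x y \<in> I" "\<And>c x. x \<in> I \<Longrightarrow> fscale c x \<in> I"
    "\<And>a x. a \<in> FA \<Longrightarrow> x \<in> I \<Longrightarrow> fmul a x \<in> I" "\<And>a x. a \<in> FA \<Longrightarrow> x \<in> I \<Longrightarrow> fmul x a \<in> I"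
    using assms unfolding is_ideal_def by auto
  have "a * x \<in> up I \<and> x * a \<in> up I" if "x \<in> up I" for a x
  proof -
    obtain y where y: "a = scl (coef a []) 1 + y" "coef y [] = 0" by (rule coef_split)
    have *: "a * x = scl (coef a []) x + y * x" "x * a = scl (coef a []) x + x * y"
      by (subst y, simp add: algebra_simps)+
    show ?thesis unfolding *
      using that y(2) by (simp add: up_def plus_falg.rep_eq times_falg.rep_eq scl.rep_eq I FA_iff)
  qed
  then show ?thesis
    using I(1-3) unfolding uideal_def by (auto simp: up_def zero_falg.rep_eq plus_falg.rep_eq scl.rep_eq)
qed

text \<open>Since \<open>FA\<close> is itself an ideal containing \<open>X\<close>, the intersection
  in \<open>gen_ideal\<close> is over a nonempty family and stays inside \<open>FA\<close>.\<close>

lemma is_ideal_gen_ideal: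
  assumes "X \<subseteq> FA" shows "is_ideal (gen_ideal X)" "X \<subseteq> gen_ideal X" "gen_ideal X \<subseteq> FA"
proof -
  have "coef (x * y) [] = 0" if "coef x [] = 0 \<or> coef y [] = 0" for x y :: "('a, 'b) falg"
    using that by (auto simp: times_falg.rep_eq fmul_def)
  then have "is_ideal (FA :: ('a, 'b) fa set)"
    unfolding is_ideal_def
    by (auto elim!: FA_coefE simp: FA_iff simp flip: zero_falg.rep_eq plus_falg.rep_eq scl.rep_eq times_falg.rep_eq)
       (auto simp: zero_falg.rep_eq fzero_def plus_falg.rep_eq fadd_def scl.rep_eq fscale_def)
  with assms show "gen_ideal X \<subseteq> FA" unfolding gen_ideal_def by blast
  then show "is_ideal (gen_ideal X)"
    unfolding is_ideal_def gen_ideal_def by blast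
  show "X \<subseteq> gen_ideal X" unfolding gen_ideal_def by blast
qed

text \<open>The elements of \<open>I\<close> without constant term form an ideal of
  \<open>FA\<close> containing \<open>X\<close>. The cut is made because \<open>I\<close> may
  contain elements with a constant term.\<close>

lemma up_gen_ideal_least:
  fixes X :: "('a, 'b::comm_ring_1) fa set"
  assumes "X \<subseteq> FA" and "uideal I" and "up X \<subseteq> I"
  shows "up (gen_ideal X) \<subseteq> I"
proof -
  have U: "0 \<in> I" "\<And>x y. x \<in> I \<Longrightarrow> y \<in> I \<Longrightarrow> x + y \<in> I" "\<And>c x. x \<in> I \<Longrightarrow> scl c x \<in> I"
    "\<And>a x. x \<in> I \<Longrightarrow> a * x \<in> I" "\<And>a x. x \<in> I \<Longrightarrow> x * a \<in> I"
    using assms(2) unfolding uideal_def by auto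
  let ?I = "coef ` {x \<in> I. coef x [] = 0}"
  have "is_ideal ?I"
    unfolding is_ideal_def
  proof (intro conjI ballI allI)
    show "?I \<subseteq> FA" by (auto simp: FA_iff)
    show "fzero \<in> ?I"
      by (rule image_eqI[of _ _ 0]) (auto simp: zero_falg.rep_eq fzero_def U)
    fix f g :: "('a, 'b) fa" assume "f \<in> ?I"
    then obtain x where x: "f = coef x" "x \<in> I" "coef x [] = 0" by auto
    show "fscale c f \<in> ?I" for c
      by (rule image_eqI[of _ _ "scl c x"]) (use x in \<open>auto simp: scl.rep_eq fscale_def U\<close>)
    { assume "g \<in> ?I"
      then obtain y where y: "g = coef y" "y \<in> I" "coef y [] = 0" by auto
      show "fadd f g \<in> ?I"
        by (rule image_eqI[of _ _ "x + y"]) (use x y in \<open>auto simp: plus_falg.rep_eq fadd_def U\<close>) }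
    { assume "g \<in> FA"
      then obtain y where y: "g = coef y" "coef y [] = 0" by (rule FA_coefE)
      show "fmul g f \<in> ?I"
        by (rule image_eqI[of _ _ "y * x"]) (use x y in \<open>auto simp: times_falg.rep_eq fmul_def U\<close>)
      show "fmul f g \<in> ?I"
        by (rule image_eqI[of _ _ "x * y"]) (use x y in \<open>auto simp: times_falg.rep_eq fmul_def U\<close>) }
  qed
  moreover have "X \<subseteq> ?I"
  proof
    fix f assume "f \<in> X"
    with assms(1) obtain x where "f = coef x" "coef x [] = 0" using FA_coefE by blast
    with \<open>f \<in> X\<close> assms(3) show "f \<in> ?I" by (auto simp: up_def)
  qed
  ultimately have "gen_ideal X \<subseteq> ?I" unfolding gen_ideal_def by blast
  then show ?thesis by (auto simp: up_def coef_inject)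
qed

lemma uidealD:
  assumes "uideal I"
  shows "0 \<in> I" "x \<in> I \<Longrightarrow> y \<in> I \<Longrightarrow> x + y \<in> I" "x \<in> I \<Longrightarrow> scl c x \<in> I"
    "x \<in> I \<Longrightarrow> a * x \<in> I" "x \<in> I \<Longrightarrow> x * a \<in> I" "x \<in> I \<Longrightarrow> y \<in> I \<Longrightarrow> x - y \<in> I"
proof -
  show I: "0 \<in> I" "\<And>x y. x \<in> I \<Longrightarrow> y \<in> I \<Longrightarrow> x + y \<in> I" "x \<in> I \<Longrightarrow> scl c x \<in> I"
    "\<And>a x. x \<in> I \<Longrightarrow> a * x \<in> I" "x \<in> I \<Longrightarrow> x * a \<in> I"
    using assms unfolding uideal_def by auto
  show "x \<in> I \<Longrightarrow> y \<in> I \<Longrightarrow> x - y \<in> I"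
    using I(2)[of x "- 1 * y"] I(4)[of y "- 1"] by simp
qed

lift_definition proj :: "('a gen list \<Rightarrow> bool) \<Rightarrow> ('a, 'r::comm_ring_1) falg \<Rightarrow> ('a, 'r) falg" is
  "\<lambda>Q f w. if Q w then f w else 0"
  by (auto elim: rev_finite_subset)

lemma proj_linear:
  "proj Q (x + y) = proj Q x + proj Q y" "proj Q (scl c x) = scl c (proj Q x)" "proj Q 0 = 0"
  by (transfer, auto simp: fadd_def fscale_def fzero_def)+

lemma proj_sum: "proj Q (sum f A) = (\<Sum>i\<in>A. proj Q (f i))"
  by (induction A rule: infinite_finite_induct) (auto simp: proj_linear)

lemma proj_mon: "proj Q (mon w) = (if Q w then mon w else 0)"
  by transfer (auto simp: fzero_def)

section \<open>Paths\<close>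

locale lc_kgraph =
  fixes k :: nat and G :: "'a kgraph"
  assumes kgraph: "is_kgraph k G" and rfin: "row_finite G" and lconv: "locally_convex k G"
begin

lemma dadd_plus: "dadd m n = m + n"
  by (simp add: dadd_def fun_eq_iff)

lemma in_Nk_simps [simp]: "in_Nk k 0" "in_Nk k m \<Longrightarrow> in_Nk k n \<Longrightarrow> in_Nk k (m + n)"
    "in_Nk k m \<Longrightarrow> in_Nk k (m - n)" "i < k \<Longrightarrow> in_Nk k (ebasis i)"
  by (auto simp: in_Nk_def ebasis_def)

lemma path_simps [simp]:
  assumes "l \<in> paths G"
  shows "rng G l \<in> paths G" "src G l \<in> paths G" "rng G (rng G l) = rng G l" "src G (rng G l) = rng G l"
    "rng G (src G l) = src G l" "src G (src G l) = src G l" "cmp G (rng G l) l = l" "cmp G l (src G l) = l"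
    "deg G (rng G l) = 0" "deg G (src G l) = 0" "in_Nk k (deg G l)" "rng G l \<in> verts G" "src G l \<in> verts G"
  using kgraph assms unfolding is_kgraph_def verts_def zero_fun_def by auto

lemma cmp_simps [simp]:
  assumes "l \<in> paths G" "m \<in> paths G" "src G l = rng G m"
  shows "cmp G l m \<in> paths G" "rng G (cmp G l m) = rng G l" "src G (cmp G l m) = src G m"
    "deg G (cmp G l m) = deg G l + deg G m"
  using kgraph assms unfolding is_kgraph_def dadd_plus by auto

lemma cmp_assoc:
  "l \<in> paths G \<Longrightarrow> m \<in> paths G \<Longrightarrow> n \<in> paths G \<Longrightarrow> src G l = rng G m \<Longrightarrow> src G m = rng G n \<Longrightarrow>
    cmp G (cmp G l m) n = cmp G l (cmp G m n)"
  using kgraph unfolding is_kgraph_def by blast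

lemma factorization:
  "l \<in> paths G \<Longrightarrow> in_Nk k m \<Longrightarrow> in_Nk k n \<Longrightarrow> deg G l = m + n \<Longrightarrow>
    \<exists>!p. fst p \<in> paths G \<and> snd p \<in> paths G \<and> src G (fst p) = rng G (snd p) \<and>
      deg G (fst p) = m \<and> deg G (snd p) = n \<and> l = cmp G (fst p) (snd p)"
  using kgraph unfolding is_kgraph_def dadd_plus by blast

lemma split_path:
  assumes "l \<in> paths G" and "m \<le> deg G l"
  obtains a b where "a \<in> paths G" "b \<in> paths G" "src G a = rng G b" "deg G a = m"
    "deg G b = deg G l - m" "l = cmp G a b"
proof -
  have "in_Nk k m"
    using path_simps(11)[OF assms(1)] assms(2) by (auto simp: in_Nk_def le_fun_def) (metis le_zero_eq)
  moreover have "deg G l = m + (deg G l - m)"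
    using assms(2) by (auto simp: fun_eq_iff le_fun_def)
  moreover have "in_Nk k (deg G l - m)" using assms(1) by simp
  ultimately obtain p where "fst p \<in> paths G" "snd p \<in> paths G" "src G (fst p) = rng G (snd p)"
    "deg G (fst p) = m" "deg G (snd p) = deg G l - m" "l = cmp G (fst p) (snd p)"
    using factorization[OF assms(1), of m "deg G l - m"] by blast
  then show ?thesis by (rule that)
qed

text \<open>Equal degrees of the first factors force equal degrees of the second ones, so both pairs
  are the unique factorization of one path.\<close>

lemma cmp_inject:
  assumes "a \<in> paths G" "b \<in> paths G" "a' \<in> paths G" "b' \<in> paths G"
    and "src G a = rng G b" "src G a' = rng G b'" "deg G a = deg G a'" "cmp G a b = cmp G a' b'"
  shows "a = a'" "b = b'"
proof -
  have "deg G a + deg G b = deg G a' + deg G b'"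
    using assms by (metis cmp_simps(4))
  with assms(7) have "deg G b = deg G b'" by simp
  then have "(a, b) = (a', b')"
    using factorization[of "cmp G a b" "deg G a" "deg G b"] assms
    by (metis (no_types, lifting) cmp_simps(1,4) fst_conv path_simps(11) snd_conv)
  then show "a = a'" "b = b'" by auto
qed

text \<open>A path of degree zero equals both \<open>cmp G (rng G v) v\<close> and
  \<open>cmp G v (src G v)\<close>; uniqueness of the factorization of degree 0 + 0 identifies the
  factors.\<close>

lemma vertsD [simp]:
  assumes "v \<in> verts G"
  shows "v \<in> paths G" "deg G v = 0" "rng G v = v" "src G v = v"
proof -
  show v: "v \<in> paths G" "deg G v = 0"
    using assms by (auto simp: verts_def zero_fun_def)
  have "cmp G (rng G v) v = cmp G v (src G v)" using v by simp
  note eq = cmp_inject[OF _ _ _ _ _ _ _ this]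
  show "rng G v = v" by (rule eq(1)) (use v in simp_all)
  show "src G v = v" by (rule eq(2)[symmetric]) (use v in simp_all)
qed

lemma verts_iff: "v \<in> verts G \<longleftrightarrow> v \<in> paths G \<and> deg G v = 0"
  unfolding verts_def zero_fun_def by blast

section \<open>Paths that are maximal below a degree bound\<close>

definition edge :: "'a \<Rightarrow> nat \<Rightarrow> bool" where
  "edge v i \<longleftrightarrow> (\<exists>m\<in>paths G. rng G m = v \<and> deg G m = ebasis i)"

abbreviation "LE n \<equiv> le_paths k G n"

lemma LE_iff:
  "l \<in> LE n \<longleftrightarrow> l \<in> paths G \<and> deg G l \<le> n \<and> (\<forall>i<k. deg G l i < n i \<longrightarrow> \<not> edge (src G l) i)"
  by (simp add: le_paths_def edge_def)

lemma LE_path [simp]: "l \<in> LE n \<Longrightarrow> l \<in> paths G"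
  by (simp add: LE_iff)

lemma LE_0 [simp]: "LE 0 = verts G"
proof -
  have "d \<le> 0 \<longleftrightarrow> d = 0" for d :: "nat \<Rightarrow> nat" by (auto simp: le_fun_def fun_eq_iff)
  then have "l \<in> LE 0 \<longleftrightarrow> l \<in> paths G \<and> deg G l = 0" for l by (simp add: LE_iff)
  then show ?thesis unfolding verts_iff[symmetric] by blast
qed

lemma LE_deg: "l \<in> paths G \<Longrightarrow> l \<in> LE (deg G l)"
  by (simp add: LE_iff)

lemma edge_if_deg:
  assumes "l \<in> paths G" and "deg G l i > 0"
  shows "i < k" "edge (rng G l) i"
proof -
  show "i < k"
    using path_simps(11)[OF assms(1)] assms(2) by (auto simp: in_Nk_def intro: leI)
  have "ebasis i \<le> deg G l"
    using assms(2) by (auto simp: ebasis_def le_fun_def)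
  with assms(1) obtain a b where "a \<in> paths G" "b \<in> paths G" "src G a = rng G b" "deg G a = ebasis i" "l = cmp G a b"
    by (rule split_path)
  then show "edge (rng G l) i" by (auto simp: edge_def)
qed

text \<open>Putting \<open>a\<close> in front changes neither the source nor the gap between degree
  and bound.\<close>

lemma LE_cmp:
  assumes "a \<in> paths G" "c \<in> LE n" "src G a = rng G c"
  shows "cmp G a c \<in> LE (deg G a + n)"
  using assms by (auto simp: LE_iff le_fun_def)

text \<open>If \<open>m\<close> exceeded \<open>l\<close> in direction \<open>i\<close>, then
  \<open>a\<close> would have positive degree there and supply an edge at \<open>src G l\<close>.
  But \<open>l\<close> is still below \<open>n\<close> in that direction, where \<open>LE n\<close>
  forbids such an edge.\<close>

lemma LE_deg_le:
  assumes "l \<in> LE n" "a \<in> paths G" "src G l = rng G a" "m \<in> paths G" "b \<in> paths G" "src G m = rng G b"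
    and "cmp G l a = cmp G m b" "deg G m \<le> n"
  shows "deg G m \<le> deg G l"
proof (rule le_funI, rule ccontr)
  fix i assume "\<not> deg G m i \<le> deg G l i"
  moreover have "deg G l i + deg G a i = deg G m i + deg G b i"
    using arg_cong[OF assms(7), of "\<lambda>x. deg G x i"] assms(1-6) by simp
  ultimately have "deg G a i > 0" "deg G l i < deg G m i" by auto
  moreover have "deg G m i \<le> n i" using assms(8) by (simp add: le_fun_def)
  ultimately show False
    using edge_if_deg[of a i] assms by (auto simp: LE_iff)
qed

text \<open>The combinatorial content of (KP3): two members of \<open>LE n\<close> with a common
  extension have equal degrees by \<open>LE_deg_le\<close> in both directions, hence
  coincide.\<close>

lemma LE_unique:
  assumes "l \<in> LE n" "a \<in> paths G" "src G l = rng G a" "m \<in> LE n" "b \<in> paths G" "src G m = rng G b"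
    and "cmp G l a = cmp G m b"
  shows "l = m"
proof (rule cmp_inject)
  show "deg G l = deg G m"
    using LE_deg_le[of l n a m b] LE_deg_le[of m n b l a] assms by (auto simp: LE_iff)
qed (use assms in auto)

lemma finite_degs:
  assumes "in_Nk k n" shows "finite {d. d \<le> (n :: nat \<Rightarrow> nat)}"
proof (rule finite_subset)
  show "{d. d \<le> n} \<subseteq> {f. \<forall>x. (x \<in> {..<k} \<longrightarrow> f x \<in> {..sum n {..<k}}) \<and> (x \<notin> {..<k} \<longrightarrow> f x = 0)}"
  proof (clarsimp, intro conjI impI)
    fix d i assume d: "d \<le> n"
    show "d i \<le> sum n {..<k}" if "i < k"
      using le_funD[OF d, of i] member_le_sum[of i "{..<k}" n] that by auto
    show "d i = 0" if "\<not> i < k"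
      using le_funD[OF d, of i] assms that by (auto simp: in_Nk_def)
  qed
qed (rule finite_set_of_finite_funs, auto)

lemma finite_LE: 
  assumes "in_Nk k n" "v \<in> verts G" shows "finite {l \<in> LE n. rng G l = v}"
proof (rule finite_subset)
  show "{l \<in> LE n. rng G l = v} \<subseteq> (\<Union>d\<in>{d. d \<le> n}. {l \<in> paths G. rng G l = v \<and> deg G l = d})"
    by (auto simp: LE_iff)
  show "finite (\<Union>d\<in>{d. d \<le> n}. {l \<in> paths G. rng G l = v \<and> deg G l = d})"
    using rfin assms by (intro finite_UN_I finite_degs) (auto simp: row_finite_def)
qed

text \<open>A path of greatest total degree among those with range \<open>v\<close> and degree at
  most \<open>n\<close> works: an edge in a deficient direction would prolong it.\<close>

lemma LE_nonempty:
  assumes "in_Nk k n" "v \<in> verts G" shows "\<exists>l\<in>LE n. rng G l = v"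
proof -
  let ?Q = "\<lambda>l. l \<in> paths G \<and> rng G l = v \<and> deg G l \<le> n"
  let ?f = "\<lambda>l. sum (deg G l) {..<k}"
  have "?f l \<le> sum n {..<k}" if "?Q l" for l
    using that by (intro sum_mono) (auto simp: le_fun_def)
  moreover have "?Q v" using assms by (auto simp: le_fun_def)
  \<comment> \<open>\<open>ex_has_greatest_nat\<close> asks for a strict bound, hence the
    \<open>Suc\<close>.\<close>
  ultimately obtain l where l: "?Q l" and max: "\<And>m. ?Q m \<Longrightarrow> ?f m \<le> ?f l"
    using ex_has_greatest_nat[of ?Q v ?f "Suc (sum n {..<k})"] unfolding less_Suc_eq_le by blast
  have "\<not> edge (src G l) i" if i: "i < k" "deg G l i < n i" for i
  proof
    assume "edge (src G l) i"
    then obtain m where m: "m \<in> paths G" "rng G m = src G l" "deg G m = ebasis i"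
      by (auto simp: edge_def)
    then have "?Q (cmp G l m)"
      using l i by (auto simp: le_fun_def ebasis_def)
    from max[OF this] l m have "sum (ebasis i) {..<k} = 0"
      by (simp add: sum.distrib)
    with i show False by (simp add: ebasis_def)
  qed
  with l show ?thesis by (auto simp: LE_iff)
qed

text \<open>The one application of \<open>lconv\<close>: the first edge of \<open>l\<close> has a
  direction other than \<open>i\<close>, so an edge in direction \<open>i\<close> persists at its
  source; induction on the total degree carries it to the end of \<open>l\<close>.\<close>

lemma convex_edge:
  assumes "l \<in> paths G" "edge (rng G l) i" "deg G l i = 0"
  shows "edge (src G l) i"
  using assms
proof (induction "sum (deg G l) {..<k}" arbitrary: l rule: less_induct)
  case less
  show ?case
  proof (cases "deg G l = 0")
    case True
    with less.prems show ?thesis by (metis verts_iff vertsD(3,4))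
  next
    case False
    then obtain j where j: "deg G l j > 0" by (auto simp: fun_eq_iff)
    from less.prems(1) j have jk: "j < k" by (rule edge_if_deg)
    from less.prems j have ij: "i \<noteq> j" by auto
    have "ebasis j \<le> deg G l"
      using j by (auto simp: ebasis_def le_fun_def)
    with less.prems(1) obtain a b where ab: "a \<in> paths G" "b \<in> paths G" "src G a = rng G b" "deg G a = ebasis j" "l = cmp G a b"
      by (rule split_path)
    from less.prems(2) obtain m where m: "m \<in> paths G" "rng G m = rng G l" "deg G m = ebasis i"
      by (auto simp: edge_def)
    from m less.prems(1) have "i < k"
      by (intro edge_if_deg(1)[of m]) (auto simp: ebasis_def)
    have "rng G l = rng G a" using ab by simp
    with lconv m ab(1,4) ij jk \<open>i < k\<close> less.prems(1) have "edge (src G a) i"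
      unfolding locally_convex_def edge_def by (metis path_simps(12))
    then have "edge (rng G b) i" using ab(3) by simp
    moreover have "sum (deg G b) {..<k} < sum (deg G l) {..<k}"
      using ab jk by (simp add: sum.distrib ebasis_def)
    moreover have "deg G b i = 0" using less.prems(3) ab by simp
    ultimately have "edge (src G b) i"
      using less.hyps ab by blast
    then show ?thesis using ab by simp
  qed
qed

text \<open>Cut \<open>l\<close> at the componentwise minimum of its degree and \<open>n\<close>. In
  a direction where the piece \<open>a\<close> stays below \<open>n\<close>, the remainder
  \<open>b\<close> has degree zero, so by \<open>convex_edge\<close> an edge at the end of
  \<open>a\<close> would survive to the end of \<open>l\<close>, against
  \<open>l \<in> LE n'\<close>.\<close>

lemma LE_truncate:
  assumes "l \<in> LE n'" "n \<le> n'"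
  obtains a b where "a \<in> LE n" "b \<in> paths G" "src G a = rng G b" "l = cmp G a b"
proof -
  have "inf (deg G l) n \<le> deg G l" by simp
  with LE_path[OF assms(1)] obtain a b where ab: "a \<in> paths G" "b \<in> paths G" "src G a = rng G b"
    "deg G a = inf (deg G l) n" "deg G b = deg G l - inf (deg G l) n" "l = cmp G a b"
    by (rule split_path)
  have "\<not> edge (src G a) i" if i: "i < k" "deg G a i < n i" for i
  proof
    assume "edge (src G a) i"
    moreover have d: "deg G l i < n i" "deg G b i = 0"
      using ab(4,5) i by (auto simp: inf_nat_def)
    ultimately have "edge (src G b) i"
      using convex_edge[OF ab(2)] ab(3) by simp
    moreover have "deg G l i < n' i" using d(1) le_funD[OF assms(2), of i] by simp
    moreover have "src G l = src G b" unfolding ab(6) using ab(1-3) by simp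
    ultimately show False using assms(1) i(1) unfolding LE_iff by metis
  qed
  moreover have "deg G a \<le> n" using ab(4) by (simp add: le_fun_def)
  ultimately have "a \<in> LE n" using ab(1) unfolding LE_iff by blast
  with ab that show ?thesis by blast
qed

subsection \<open>Boundary paths\<close>

text \<open>A boundary path is encoded by the set of its finite initial segments.\<close>

definition bdry :: "'a set \<Rightarrow> bool" where
  "bdry X \<longleftrightarrow> X \<subseteq> paths G \<and>
     (\<forall>m\<in>paths G. \<forall>c\<in>paths G. src G m = rng G c \<longrightarrow> cmp G m c \<in> X \<longrightarrow> m \<in> X) \<and>
     (\<forall>l\<in>X. \<forall>m\<in>X. \<exists>a\<in>paths G. \<exists>b\<in>paths G. src G l = rng G a \<and> src G m = rng G b \<and>
        cmp G l a = cmp G m b \<and> cmp G l a \<in> X) \<and>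
     (\<forall>n. in_Nk k n \<longrightarrow> (\<exists>l\<in>X. l \<in> LE n))"

lemma bdryD:
  assumes "bdry X"
  shows bdry_path: "\<And>l. l \<in> X \<Longrightarrow> l \<in> paths G"
    and bdry_prefix: "\<And>m c. m \<in> paths G \<Longrightarrow> c \<in> paths G \<Longrightarrow> src G m = rng G c \<Longrightarrow> cmp G m c \<in> X \<Longrightarrow> m \<in> X"
    and bdry_LE: "\<And>n. in_Nk k n \<Longrightarrow> \<exists>l\<in>X. l \<in> LE n"
  using assms unfolding bdry_def by blast+

lemma bdry_join:
  assumes "bdry X" "l \<in> X" "m \<in> X"
  obtains a b where "a \<in> paths G" "b \<in> paths G" "src G l = rng G a" "src G m = rng G b"
    "cmp G l a = cmp G m b" "cmp G l a \<in> X"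
  using assms unfolding bdry_def by blast

lemma bdry_rng:
  assumes "bdry X" "l \<in> X" shows "rng G l \<in> X"
  using bdry_prefix[OF assms(1), of "rng G l" l] bdry_path[OF assms] assms(2) by simp

lemma bdry_rng_unique:
  assumes "bdry X" "l \<in> X" "m \<in> X" shows "rng G l = rng G m"
proof -
  from assms obtain a b where "a \<in> paths G" "b \<in> paths G" "src G l = rng G a" "src G m = rng G b"
    "cmp G l a = cmp G m b" by (rule bdry_join)
  then show ?thesis using assms bdry_path by (metis cmp_simps(2))
qed

lemma bdry_vert: "bdry X \<Longrightarrow> v \<in> X \<Longrightarrow> v \<in> verts G \<Longrightarrow> l \<in> X \<Longrightarrow> rng G l = v"
  using bdry_rng_unique[of X l v] by simp

text \<open>With the last clause of \<open>bdry\<close>, which stands for maximality, each bound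
  \<open>n\<close> singles out exactly one segment. This is what makes (KP3) and (KP4) hold on
  boundary paths.\<close>

lemma bdry_LE_unique:
  assumes "bdry X" "l \<in> X" "m \<in> X" "l \<in> LE n" "m \<in> LE n" shows "l = m"
proof -
  from assms(1-3) obtain a b where "a \<in> paths G" "b \<in> paths G" "src G l = rng G a" "src G m = rng G b"
    "cmp G l a = cmp G m b" by (rule bdry_join)
  with assms show ?thesis by (intro LE_unique[of l n a m b])
qed

text \<open>The boundary path with \<open>l\<close> put in front. The products
  \<open>cmp G l x\<close> alone are in general not closed under initial segments, so all their
  segments are taken.\<close>

definition shift :: "'a \<Rightarrow> 'a set \<Rightarrow> 'a set" where
  "shift l X = {m \<in> paths G. \<exists>x\<in>X. \<exists>c\<in>paths G. src G m = rng G c \<and> cmp G m c = cmp G l x}"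

text \<open>The boundary path with the initial segment \<open>l\<close> deleted, that is, the usual
  shift map of degree \<open>deg G l\<close>.\<close>

definition unshift :: "'a \<Rightarrow> 'a set \<Rightarrow> 'a set" where
  "unshift l X = {m \<in> paths G. src G l = rng G m \<and> cmp G l m \<in> X}"

lemma shiftI:
  "m \<in> paths G \<Longrightarrow> x \<in> X \<Longrightarrow> c \<in> paths G \<Longrightarrow> src G m = rng G c \<Longrightarrow> cmp G m c = cmp G l x \<Longrightarrow> m \<in> shift l X"
  by (auto simp: shift_def)

lemma cmp_src [simp]:
  assumes "l \<in> paths G" "m \<in> paths G" "src G l = rng G m"
  shows "cmp G (cmp G l m) (src G m) = cmp G l m"
  using path_simps(8)[OF cmp_simps(1)[OF assms]] cmp_simps(3)[OF assms] by simp

text \<open>Common extensions are found in \<open>X\<close> and then prefixed by \<open>l\<close>.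
  The last clause of \<open>bdry\<close> is the delicate one: \<open>cmp G l x\<close> lies in
  \<open>LE (deg G l + n)\<close> and has to be cut back to \<open>n\<close>, which
  \<open>LE_truncate\<close> permits.\<close>

lemma bdry_shift:
  assumes X: "bdry X" and l: "l \<in> paths G" "src G l \<in> X"
  shows "bdry (shift l X)"
proof -
  note path = bdry_path[OF X]
  have r: "rng G x = src G l" if "x \<in> X" for x
    using bdry_vert[OF X l(2)] l(1) that by simp
  have cmp_mem: "cmp G l x \<in> shift l X" if "x \<in> X" for x
    using that path r l by (intro shiftI[of _ x _ "src G x"]) simp_all
  show ?thesis
    unfolding bdry_def
  proof (intro conjI ballI allI impI)
    show "shift l X \<subseteq> paths G" by (auto simp: shift_def)
    show "m \<in> shift l X" if m: "m \<in> paths G" "c \<in> paths G" "src G m = rng G c" "cmp G m c \<in> shift l X" for m c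
    proof -
      from m(4) obtain x d where x: "x \<in> X" "d \<in> paths G" "src G (cmp G m c) = rng G d" "cmp G (cmp G m c) d = cmp G l x"
        by (auto simp: shift_def)
      with m have "cmp G m (cmp G c d) = cmp G l x" by (simp add: cmp_assoc)
      with m x show ?thesis by (intro shiftI[of _ x _ "cmp G c d"]) simp_all
    qed
    show "\<exists>a\<in>paths G. \<exists>b\<in>paths G. src G p = rng G a \<and> src G q = rng G b \<and>
        cmp G p a = cmp G q b \<and> cmp G p a \<in> shift l X" if pq: "p \<in> shift l X" "q \<in> shift l X" for p q
    proof -
      from pq obtain x c y d where xc: "p \<in> paths G" "q \<in> paths G" "x \<in> X" "c \<in> paths G" "src G p = rng G c" "cmp G p c = cmp G l x"
        "y \<in> X" "d \<in> paths G" "src G q = rng G d" "cmp G q d = cmp G l y"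
        by (auto simp: shift_def)
      from X xc(3,7) obtain a b where ab: "a \<in> paths G" "b \<in> paths G" "src G x = rng G a" "src G y = rng G b"
        "cmp G x a = cmp G y b" "cmp G x a \<in> X"
        by (rule bdry_join)
      have s: "src G c = src G x" "src G d = src G y"
        using arg_cong[OF xc(6), of "src G"] arg_cong[OF xc(10), of "src G"] xc(1-5,7-9) path r l by auto
      have "cmp G p (cmp G c a) = cmp G l (cmp G x a)"
        using xc ab s path r l by (metis cmp_assoc)
      moreover have "cmp G q (cmp G d b) = cmp G l (cmp G y b)"
        using xc ab s path r l by (metis cmp_assoc)
      ultimately show ?thesis
        using ab xc s cmp_mem[OF ab(6)]
        by (intro bexI[of _ "cmp G c a"] bexI[of _ "cmp G d b"]) auto
    qed
    show "\<exists>p\<in>shift l X. p \<in> LE n" if n: "in_Nk k n" for n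
    proof -
      from bdry_LE[OF X n] obtain x where x: "x \<in> X" "x \<in> LE n" by blast
      with l r have "cmp G l x \<in> LE (deg G l + n)" by (intro LE_cmp) auto
      moreover have "n \<le> deg G l + n" by (simp add: le_fun_def)
      ultimately obtain a b where "a \<in> LE n" "b \<in> paths G" "src G a = rng G b" "cmp G l x = cmp G a b"
        by (rule LE_truncate)
      with x show ?thesis by (intro bexI[of _ a] shiftI[of _ x _ b]) simp_all
    qed
  qed
qed

lemma bdry_unshift:
  assumes X: "bdry X" and l: "l \<in> X"
  shows "bdry (unshift l X)"
proof -
  have lp [simp]: "l \<in> paths G" using bdry_path[OF X l] .
  show ?thesis
    unfolding bdry_def
  proof (intro conjI ballI allI impI)
    show "unshift l X \<subseteq> paths G" by (auto simp: unshift_def)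
    show "m \<in> unshift l X" if m: "m \<in> paths G" "c \<in> paths G" "src G m = rng G c" "cmp G m c \<in> unshift l X" for m c
    proof -
      from m have "src G l = rng G m" "cmp G (cmp G l m) c \<in> X"
        by (auto simp: unshift_def cmp_assoc)
      with m show ?thesis using bdry_prefix[OF X, of "cmp G l m" c] by (auto simp: unshift_def)
    qed
    show "\<exists>a\<in>paths G. \<exists>b\<in>paths G. src G p = rng G a \<and> src G q = rng G b \<and>
        cmp G p a = cmp G q b \<and> cmp G p a \<in> unshift l X" if "p \<in> unshift l X" "q \<in> unshift l X" for p q
    proof -
      from that have pq: "p \<in> paths G" "src G l = rng G p" "cmp G l p \<in> X" "q \<in> paths G" "src G l = rng G q" "cmp G l q \<in> X"
        by (auto simp: unshift_def)
      from X pq(3,6) obtain a b where ab: "a \<in> paths G" "b \<in> paths G" "src G (cmp G l p) = rng G a"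
        "src G (cmp G l q) = rng G b" "cmp G (cmp G l p) a = cmp G (cmp G l q) b" "cmp G (cmp G l p) a \<in> X"
        by (rule bdry_join)
      from ab pq have ab': "cmp G l (cmp G p a) = cmp G l (cmp G q b)" "src G p = rng G a" "src G q = rng G b"
        "cmp G l (cmp G p a) \<in> X"
        by (simp_all add: cmp_assoc)
      have "cmp G p a = cmp G q b"
        by (rule cmp_inject(2)[OF _ _ _ _ _ _ _ ab'(1)]) (use ab ab' pq in simp_all)
      moreover have "cmp G p a \<in> unshift l X"
        using ab ab' pq by (simp add: unshift_def)
      ultimately show ?thesis using ab(1,2) ab'(2,3) by blast
    qed
    show "\<exists>p\<in>unshift l X. p \<in> LE n" if n: "in_Nk k n" for n
    proof -
      have "in_Nk k (deg G l + n)" using n by simp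
      from bdry_LE[OF X this] obtain x where x: "x \<in> X" "x \<in> LE (deg G l + n)" by blast
      from X x(1) l obtain a b where ab: "a \<in> paths G" "b \<in> paths G" "src G x = rng G a" "src G l = rng G b"
        "cmp G x a = cmp G l b" by (rule bdry_join)
      \<comment> \<open>Membership in \<open>LE (deg G l + n)\<close> makes \<open>x\<close> at
        least as long as \<open>l\<close> in every direction; having a common extension with
        \<open>l\<close>, it therefore starts with \<open>l\<close>.\<close>
      have "deg G l \<le> deg G x"
        by (rule LE_deg_le[OF x(2) ab(1,3) lp ab(2,4,5)]) (simp add: le_fun_def)
      with LE_path[OF x(2)] obtain c d where cd: "c \<in> paths G" "d \<in> paths G" "src G c = rng G d" "deg G c = deg G l"
        "deg G d = deg G x - deg G l" "x = cmp G c d"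
        by (rule split_path)
      have s: "src G d = src G x" unfolding cd(6) using cd(1-3) by simp
      have da: "src G d = rng G a" using s ab(3) by simp
      have "cmp G c (cmp G d a) = cmp G (cmp G c d) a"
        using cmp_assoc[OF cd(1,2) ab(1) cd(3) da] by simp
      also have "\<dots> = cmp G l b" using ab(5) unfolding cd(6) .
      finally have "c = l"
        by (rule cmp_inject(1)[rotated 7]) (use cd(1-4) ab(1,2,4) da in simp_all)
      then have x': "x = cmp G l d" "src G l = rng G d" using cd(3,6) by auto
      have dx: "deg G x = deg G l + deg G d" unfolding x' using cd(2) x'(2) by simp
      have "d \<in> LE n"
        using x(2) cd(2) s unfolding LE_iff dx by (simp add: le_fun_def)
      with x x' show ?thesis by (intro bexI[of _ d]) (auto simp: unshift_def)
    qed
  qed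
qed

lemma unshift_shift:
  assumes X: "bdry X" and l: "l \<in> paths G" "src G l \<in> X"
  shows "unshift l (shift l X) = X"
proof -
  note path = bdry_path[OF X]
  have r: "rng G x = src G l" if "x \<in> X" for x
    using bdry_vert[OF X l(2)] l(1) that by simp
  show ?thesis
  proof (intro set_eqI iffI)
    fix m assume "m \<in> unshift l (shift l X)"
    then obtain x c where m: "m \<in> paths G" "src G l = rng G m" "x \<in> X" "c \<in> paths G"
      "src G (cmp G l m) = rng G c" "cmp G (cmp G l m) c = cmp G l x"
      by (auto simp: unshift_def shift_def)
    then have "cmp G l (cmp G m c) = cmp G l x" using l by (simp add: cmp_assoc)
    then have "cmp G m c = x"
      by (rule cmp_inject(2)[rotated 7]) (use m l r path in auto)
    with m show "m \<in> X" using bdry_prefix[OF X, of m c] l by auto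
  next
    fix m assume "m \<in> X"
    with l r path have "cmp G l m \<in> shift l X"
      by (intro shiftI[of _ m _ "src G m"]) simp_all
    with \<open>m \<in> X\<close> r path show "m \<in> unshift l (shift l X)" by (simp add: unshift_def)
  qed
qed

lemma shift_unshift:
  assumes X: "bdry X" and l: "l \<in> X"
  shows "shift l (unshift l X) = X"
proof (intro set_eqI iffI)
  fix m assume "m \<in> shift l (unshift l X)"
  then show "m \<in> X"
    using bdry_prefix[OF X, of m] by (auto simp: shift_def unshift_def)
next
  fix m assume m: "m \<in> X"
  from X m l obtain a b where "a \<in> paths G" "b \<in> paths G" "src G m = rng G a" "src G l = rng G b"
    "cmp G m a = cmp G l b" "cmp G m a \<in> X" by (rule bdry_join)
  with bdry_path[OF X m] show "m \<in> shift l (unshift l X)"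
    by (intro shiftI[of _ b _ a]) (simp_all add: unshift_def)
qed

lemma src_in_unshift:
  assumes "bdry X" "l \<in> X" shows "src G l \<in> unshift l X"
  using bdry_path[OF assms] assms(2) by (simp add: unshift_def)

lemma in_shift: "l \<in> paths G \<Longrightarrow> src G l \<in> X \<Longrightarrow> l \<in> shift l X"
  by (rule shiftI[of _ "src G l" _ "src G l"]) simp_all

lemma unshift_cmp:
  assumes "l \<in> paths G" "m \<in> paths G" "src G l = rng G m"
  shows "unshift m (unshift l X) = unshift (cmp G l m) X"
proof -
  have "cmp G m x \<in> paths G \<and> src G l = rng G (cmp G m x) \<and> cmp G l (cmp G m x) \<in> X \<longleftrightarrow>
      cmp G (cmp G l m) x \<in> X" if "x \<in> paths G" "src G m = rng G x" for x
    using assms that cmp_assoc[of l m x] cmp_simps(1,2)[of m x] by metis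
  then show ?thesis
    unfolding unshift_def using cmp_simps(3)[OF assms] by auto
qed

text \<open>Both sides become \<open>X\<close> after deleting \<open>cmp G l m\<close>, and
  \<open>shift_unshift\<close> recovers the left side from that; no comparison of segments is
  made.\<close>

lemma shift_cmp:
  assumes X: "bdry X" and "l \<in> paths G" "m \<in> paths G" "src G l = rng G m" "src G m \<in> X"
  shows "shift l (shift m X) = shift (cmp G l m) X"
proof -
  have m: "bdry (shift m X)" "m \<in> shift m X" using assms by (auto intro: bdry_shift in_shift)
  have r: "src G l \<in> shift m X" using bdry_rng[OF m] assms by simp
  have l: "bdry (shift l (shift m X))" using m r assms by (intro bdry_shift)
  have "m \<in> unshift l (shift l (shift m X))" using unshift_shift[OF m(1) _ r] m assms by simp
  then have lm: "cmp G l m \<in> shift l (shift m X)" by (simp add: unshift_def)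
  have "unshift (cmp G l m) (shift l (shift m X)) = X"
    using assms m r by (simp add: unshift_cmp[symmetric] unshift_shift)
  with shift_unshift[OF l lm] show ?thesis by simp
qed

lemma unshift_vert: "bdry X \<Longrightarrow> v \<in> verts G \<Longrightarrow> v \<in> X \<Longrightarrow> unshift v X = X"
proof (intro set_eqI)
  fix m assume *: "bdry X" "v \<in> verts G" "v \<in> X"
  then have "cmp G v m = m" if "m \<in> paths G" "rng G m = v" for m using path_simps(7)[OF that(1)] that by simp
  with bdry_vert[OF *(1,3,2), of m] bdry_path[OF *(1), of m] vertsD(4)[OF *(2)]
  show "m \<in> unshift v X \<longleftrightarrow> m \<in> X"
    unfolding unshift_def mem_Collect_eq by metis
qed

lemma shift_vert: "bdry X \<Longrightarrow> v \<in> verts G \<Longrightarrow> v \<in> X \<Longrightarrow> shift v X = X"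
  using shift_unshift[of X v] by (simp add: unshift_vert)

text \<open>Along the diagonal bounds \<open>?one N\<close> a sequence of successive extensions
  \<open>f N\<close> in \<open>LE (?one N)\<close> is chosen; the initial segments of its members
  form the boundary path.\<close>

lemma bdry_exists:
  assumes v: "v \<in> verts G" shows "\<exists>X. bdry X \<and> v \<in> X"
proof -
  let ?one = "\<lambda>N i. if i < k then N else (0 :: nat)"
  have one [simp]: "in_Nk k (?one N)" for N by (simp add: in_Nk_def)
  let ?R = "\<lambda>x y. \<exists>c\<in>paths G. src G x = rng G c \<and> y = cmp G x c"
  obtain f where f: "\<And>N. f N \<in> LE (?one N) \<and> rng G (f N) = v" and R: "\<And>N. ?R (f N) (f (Suc N))"
  proof (rule exE[OF dependent_nat_choice[of "\<lambda>N x. x \<in> LE (?one N) \<and> rng G x = v" "\<lambda>N x y. ?R x y"]])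
    show "\<exists>x. x \<in> LE (?one 0) \<and> rng G x = v"
      using LE_nonempty[OF one[of 0] v] by blast
  next
    fix x N assume "x \<in> LE (?one N) \<and> rng G x = v"
    then have x: "x \<in> LE (?one N)" "rng G x = v" by auto
    then obtain c where c: "c \<in> LE (?one 1)" "rng G c = src G x"
      using LE_nonempty[OF one[of 1], of "src G x"] by auto
    have "cmp G x c \<in> LE (?one (Suc N))"
      unfolding LE_iff
    proof (intro conjI allI impI)
      show "cmp G x c \<in> paths G" using x c by simp
      have "deg G x i + deg G c i \<le> ?one (Suc N) i" for i
        using x c le_funD[of "deg G x" "?one N" i] le_funD[of "deg G c" "?one 1" i]
        by (cases "i < k") (simp_all add: LE_iff)
      then show "deg G (cmp G x c) \<le> ?one (Suc N)" using x c by (simp add: le_fun_def)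
      fix i assume i: "i < k" "deg G (cmp G x c) i < ?one (Suc N) i"
      then have "deg G x i + deg G c i < Suc N" using x c by simp
      \<comment> \<open>Either \<open>c\<close> stops short of its bound 1 and so ends without an
        edge in direction \<open>i\<close>, or \<open>x\<close> stopped short; the latter is absurd,
        because \<open>c\<close> supplies an edge in that direction at the end of
        \<open>x\<close>.\<close>
      then consider "deg G c i = 0" "deg G x i \<le> N" | "deg G c i > 0" "deg G x i < N" by linarith
      then have "\<not> edge (src G c) i"
      proof cases
        case 1
        then show ?thesis using c(1) i(1) by (auto simp: LE_iff)
      next
        case 2
        then have "edge (src G x) i" using edge_if_deg(2)[of c i] c by simp
        with x i(1) 2 show ?thesis by (auto simp: LE_iff)
      qed
      then show "\<not> edge (src G (cmp G x c)) i" using x c by simp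
    qed
    with x c show "\<exists>y. (y \<in> LE (?one (Suc N)) \<and> rng G y = v) \<and> ?R x y"
      by (intro exI[of _ "cmp G x c"]) (auto intro!: bexI[of _ c])
  qed blast
  have path: "f N \<in> paths G" for N using f[of N] by auto
  have chain: "?R (f M) (f N)" if "M \<le> N" for M N
    using that
  proof (induction N rule: dec_induct)
    case base
    then show ?case using path by (auto intro!: bexI[of _ "src G (f M)"])
  next
    case (step N)
    then obtain c where c: "c \<in> paths G" "src G (f M) = rng G c" "f N = cmp G (f M) c" by auto
    from R[of N] obtain d where d: "d \<in> paths G" "src G (f N) = rng G d" "f (Suc N) = cmp G (f N) d" by auto
    have "src G c = rng G d" using c d(2) path[of M] by simp
    then show ?case using c d path[of M] by (auto simp: cmp_assoc intro!: bexI[of _ "cmp G c d"])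
  qed
  let ?X = "{m \<in> paths G. \<exists>N. ?R m (f N)}"
  have "bdry ?X"
    unfolding bdry_def
  proof (intro conjI ballI allI impI)
    show "m \<in> ?X" if m: "m \<in> paths G" "c \<in> paths G" "src G m = rng G c" "cmp G m c \<in> ?X" for m c
    proof -
      from m(4) obtain d N where "d \<in> paths G" "src G (cmp G m c) = rng G d" "f N = cmp G (cmp G m c) d" by blast
      with m show ?thesis by (auto simp: cmp_assoc intro!: exI[of _ N] bexI[of _ "cmp G c d"])
    qed
    show "\<exists>a\<in>paths G. \<exists>b\<in>paths G. src G p = rng G a \<and> src G q = rng G b \<and>
        cmp G p a = cmp G q b \<and> cmp G p a \<in> ?X" if pq: "p \<in> ?X" "q \<in> ?X" for p q
    proof -
      have ext: "\<exists>a\<in>paths G. src G m = rng G a \<and> f N = cmp G m a"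
        if m: "m \<in> paths G" "c \<in> paths G" "src G m = rng G c" "f M = cmp G m c" "M \<le> N" for m c M N
      proof -
        from chain[OF m(5)] obtain d where d: "d \<in> paths G" "src G (f M) = rng G d" "f N = cmp G (f M) d" by blast
        with m have "f N = cmp G m (cmp G c d)" "src G c = rng G d" by (simp_all add: cmp_assoc)
        with d m show ?thesis by (auto intro!: bexI[of _ "cmp G c d"])
      qed
      from pq obtain c d M N where cd: "p \<in> paths G" "q \<in> paths G" "c \<in> paths G" "src G p = rng G c" "f M = cmp G p c"
        "d \<in> paths G" "src G q = rng G d" "f N = cmp G q d" by blast
      from ext[OF cd(1,3-5), of "max M N"] ext[OF cd(2,6-8), of "max M N"]
      obtain a b where ab: "a \<in> paths G" "src G p = rng G a" "f (max M N) = cmp G p a"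
        "b \<in> paths G" "src G q = rng G b" "f (max M N) = cmp G q b" by auto
      have "f (max M N) \<in> ?X"
        using chain[of "max M N" "max M N"] path by blast
      then have "cmp G p a \<in> ?X" unfolding ab(3) .
      moreover have "cmp G p a = cmp G q b" using ab by simp
      ultimately show ?thesis using ab by blast
    qed
    show "\<exists>p\<in>?X. p \<in> LE n" if n: "in_Nk k n" for n
    proof -
      \<comment> \<open>The sum of the coordinates bounds each of them, so some diagonal bound
        dominates \<open>n\<close> and the corresponding \<open>f\<close> can be truncated.\<close>
      have "n \<le> ?one (sum n {..<k})"
        using n member_le_sum[of _ "{..<k}" n] by (auto simp: le_fun_def in_Nk_def)
      with f[of "sum n {..<k}"] obtain a b where "a \<in> LE n" "b \<in> paths G" "src G a = rng G b" "f (sum n {..<k}) = cmp G a b"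
        by (blast elim: LE_truncate)
      then show ?thesis by (intro bexI[of _ a] CollectI conjI exI[of _ "sum n {..<k}"] bexI[of _ b]) simp_all
    qed
  qed simp
  moreover have "v \<in> ?X"
    using f[of 0] v path[of 0] by (auto intro!: exI[of _ 0] bexI[of _ "f 0"]) 
  ultimately show ?thesis by blast
qed

end

section \<open>The Kumjian-Pask algebra\<close>

text \<open>The parameter \<open>R\<close> only fixes the type of coefficients.\<close>

locale kp_algebra = lc_kgraph k G for k :: nat and G :: "'a kgraph" +
  fixes R :: "'r::comm_ring_1 itself"
begin

abbreviation P :: "'a \<Rightarrow> ('a, 'r) falg" where "P v \<equiv> mon [Pg v]"
abbreviation S :: "'a \<Rightarrow> ('a, 'r) falg" where "S l \<equiv> mon [Sg l]"
abbreviation T :: "'a \<Rightarrow> ('a, 'r) falg" where "T l \<equiv> mon [Tg l]"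

lemma coef_gen: "pp v = coef (P v)" "sp v = coef (S v)" "sps v = coef (T v)"
  by (simp_all add: pp_def sp_def sps_def mono_def mon.rep_eq)

text \<open>The relations \<open>KPrel\<close> restated in the ring, one rule for each family, so
  that representations and degrees are checked by cases.\<close>

inductive_set rel :: "('a, 'r) falg set" where
  P_out: "v \<notin> verts G \<Longrightarrow> P v \<in> rel"
| S_out: "l \<notin> paths G \<Longrightarrow> S l \<in> rel"
| T_out: "l \<notin> paths G \<Longrightarrow> T l \<in> rel"
| S_vert: "v \<in> verts G \<Longrightarrow> S v - P v \<in> rel"
| T_vert: "v \<in> verts G \<Longrightarrow> T v - P v \<in> rel"
| PP: "v \<in> verts G \<Longrightarrow> w \<in> verts G \<Longrightarrow> P v * P w - (if v = w then P v else 0) \<in> rel"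
| SS: "l \<in> paths G \<Longrightarrow> m \<in> paths G \<Longrightarrow> src G l = rng G m \<Longrightarrow> S l * S m - S (cmp G l m) \<in> rel"
| TT: "l \<in> paths G \<Longrightarrow> m \<in> paths G \<Longrightarrow> src G l = rng G m \<Longrightarrow> T m * T l - T (cmp G l m) \<in> rel"
| PS: "l \<in> paths G \<Longrightarrow> P (rng G l) * S l - S l \<in> rel"
| SP: "l \<in> paths G \<Longrightarrow> S l * P (src G l) - S l \<in> rel"
| PT: "l \<in> paths G \<Longrightarrow> P (src G l) * T l - T l \<in> rel"
| TP: "l \<in> paths G \<Longrightarrow> T l * P (rng G l) - T l \<in> rel"
| TS: "in_Nk k n \<Longrightarrow> n \<noteq> 0 \<Longrightarrow> l \<in> LE n \<Longrightarrow> m \<in> LE n \<Longrightarrow>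
    T l * S m - (if l = m then P (src G l) else 0) \<in> rel"
| ST: "v \<in> verts G \<Longrightarrow> in_Nk k n \<Longrightarrow> n \<noteq> 0 \<Longrightarrow> P v - (\<Sum>l\<in>{l \<in> LE n. rng G l = v}. S l * T l) \<in> rel"

lemma KPrel_eq: "KPrel k G = coef ` rel"
proof
  have if_coef: "(if b then coef x else fzero) = coef (if b then x else 0)" for b and x :: "('a, 'r) falg"
    by (simp add: zero_falg.rep_eq)
  note eqs = coef_gen if_coef minus_falg.rep_eq[symmetric] times_falg.rep_eq[symmetric]
    coef_sum[symmetric] zero_fun_def[symmetric]
  show "KPrel k G \<subseteq> coef ` rel"
    unfolding KPrel_def eqs by (intro Un_least; clarify; intro imageI; blast intro: rel.intros)
  show "coef ` rel \<subseteq> KPrel k G"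
  proof (rule image_subsetI)
    fix x :: "('a, 'r) falg" assume "x \<in> rel"
    then show "coef x \<in> KPrel k G"
      by cases (simp only: KPrel_def eqs Un_iff mem_Collect_eq, blast)+
  qed
qed

definition K :: "('a, 'r) falg set" where "K = up (KPker k G)"

lemma rel_Nil: "x \<in> rel \<Longrightarrow> coef x [] = 0"
  by (induction rule: rel.induct)
     (auto simp: mon.rep_eq minus_falg.rep_eq fsub_def times_falg.rep_eq fmul_def coef_sum fsum_def zero_falg.rep_eq fzero_def)

lemma KPrel_FA: "(KPrel k G :: ('a, 'r) fa set) \<subseteq> FA"
  by (auto simp: KPrel_eq FA_iff rel_Nil)

lemma uideal_K: "uideal K"
  unfolding K_def KPker_def by (intro uideal_up is_ideal_gen_ideal(1) KPrel_FA)

lemma rel_K: "x \<in> rel \<Longrightarrow> x \<in> K"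
  using is_ideal_gen_ideal(2)[OF KPrel_FA] unfolding K_def KPker_def up_def KPrel_eq by blast

lemma K_Nil: "x \<in> K \<Longrightarrow> coef x [] = 0"
  using is_ideal_gen_ideal(3)[OF KPrel_FA] unfolding K_def KPker_def up_def FA_iff[symmetric] by blast

text \<open>The universal property in the form used below: what is verified on the relations and is
  stable as an ideal holds on all of \<open>K\<close>.\<close>

lemma K_least: "uideal I \<Longrightarrow> rel \<subseteq> I \<Longrightarrow> K \<subseteq> I"
  unfolding K_def KPker_def
  by (rule up_gen_ideal_least[OF KPrel_FA]) (auto simp: up_def KPrel_eq coef_inject)


subsection \<open>The boundary path representation\<close>


text \<open>On the indicator function of one boundary path, \<open>Sg l\<close> prepends
  \<open>l\<close> and \<open>Tg l\<close> deletes it, giving zero where this is impossible. Acting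
  on functions, the formulas evaluate at the inverse operation.\<close>

fun gact :: "'a gen \<Rightarrow> ('a set \<Rightarrow> 'r) \<Rightarrow> 'a set \<Rightarrow> 'r" where
  "gact (Pg v) f X = (if v \<in> verts G \<and> v \<in> X then f X else 0)"
| "gact (Sg l) f X = (if l \<in> X then f (unshift l X) else 0)"
| "gact (Tg l) f X = (if l \<in> paths G \<and> src G l \<in> X then f (shift l X) else 0)"

text \<open>\<open>foldr\<close> lets the leftmost letter act last, so that products act as
  compositions.\<close>

definition ev :: "('a, 'r) falg \<Rightarrow> ('a set \<Rightarrow> 'r) \<Rightarrow> 'a set \<Rightarrow> 'r" where
  "ev x f X = lin (\<lambda>w. foldr gact w f X) x"

lemma ev_linear:
  "ev (x + y) f X = ev x f X + ev y f X" "ev (x - y) f X = ev x f X - ev y f X"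
  "ev (scl c x) f X = c * ev x f X" "ev 0 f X = 0" "ev (\<Sum>i\<in>A. h i) f X = (\<Sum>i\<in>A. ev (h i) f X)"
  by (simp_all add: ev_def lin_add lin_diff lin_scl lin_0 lin_sum)

lemma ev_gen_mult: "ev (mon [g] * x) f X = gact g (ev x f) X"
proof -
  have "ev (mon [g] * x) f X = lin (\<lambda>w. gact g (foldr gact w f) X) x"
    by (simp add: ev_def lin_mon_mult)
  \<comment> \<open>Serves the branches in which \<open>gact\<close> returns 0 whatever the function
    is.\<close>
  moreover have "lin (\<lambda>w. 0) x = 0" by (simp add: lin_def)
  ultimately show ?thesis
    by (cases g) (auto simp: ev_def)
qed

lemma ev_gen: "ev (mon [g]) f X = gact g f X"
  by (simp add: ev_def lin_mon)

lemma ev_mult_mon: "ev (x * mon w) f X = ev x (foldr gact w f) X"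
  by (simp add: ev_def lin_mult_mon)

text \<open>The kernel of the action, tested only at boundary paths because the relations are
  verified only there.\<close>

definition null :: "('a, 'r) falg set" where
  "null = {x. \<forall>f X. bdry X \<longrightarrow> ev x f X = 0}"

text \<open>\<open>shift\<close> and \<open>unshift\<close> lead from boundary paths to boundary
  paths, so ignoring all other sets is compatible with the action.\<close>

lemma gact_null:
  assumes "\<And>X. bdry X \<Longrightarrow> h X = 0" "bdry X" shows "gact g h X = 0"
  using assms bdry_shift bdry_unshift by (cases g) auto

text \<open>A word multiplied from the left acts letter by letter through \<open>gact_null\<close>;
  a word multiplied from the right only replaces \<open>f\<close> by another function.\<close>

lemma uideal_null: "uideal null"
  unfolding uideal_def
proof (intro conjI ballI allI)
  fix x a :: "('a, 'r) falg" assume x: "x \<in> null"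
  have "mon w * x \<in> null" for w
  proof (induction w)
    case (Cons g w)
    have "mon (g # w) = (mon [g] * mon w :: ('a, 'r) falg)"
      using mon_append[of "[g]" w] by simp
    with Cons show ?case
      by (auto simp: null_def ev_gen_mult mult.assoc intro: gact_null)
  qed (use x in \<open>simp add: mon_Nil\<close>)
  then show "a * x \<in> null"
  proof (induction a rule: falg_induct)
    case (add c w a)
    then show ?case
      by (simp add: null_def distrib_right ev_linear)
  qed (simp add: null_def ev_linear)
  show "x * a \<in> null"
  proof (induction a rule: falg_induct)
    case (add c w a)
    have "x * scl c (mon w) = scl c (x * mon w)" by simp
    with add x show ?case
      by (simp add: null_def distrib_left ev_linear ev_mult_mon)
  qed (simp add: null_def ev_linear)
qed (auto simp: null_def ev_linear)

lemma rel_null: "rel \<subseteq> null"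
proof
  fix x :: "('a, 'r) falg" assume "x \<in> rel"
  then show "x \<in> null"
    unfolding null_def
  proof (cases, safe)
    fix X :: "'a set" and f :: "'a set \<Rightarrow> 'r"
    assume X: "bdry X"
    note path = bdry_path[OF X] and evs = ev_linear ev_gen_mult ev_gen
    show "v \<notin> verts G \<Longrightarrow> ev (P v) f X = 0" for v by (simp add: ev_gen)
    show "l \<notin> paths G \<Longrightarrow> ev (S l) f X = 0" for l using path by (auto simp: ev_gen)
    show "l \<notin> paths G \<Longrightarrow> ev (T l) f X = 0" for l by (simp add: ev_gen)
    show "v \<in> verts G \<Longrightarrow> ev (S v - P v) f X = 0" for v
      using X by (simp add: evs unshift_vert)
    show "v \<in> verts G \<Longrightarrow> ev (T v - P v) f X = 0" for v
      using X by (simp add: evs shift_vert)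
    show "v \<in> verts G \<Longrightarrow> w \<in> verts G \<Longrightarrow> ev (P v * P w - (if v = w then P v else 0)) f X = 0" for v w
      using bdry_vert[OF X, of v w] by (auto simp: evs)
    show "ev (S l * S m - S (cmp G l m)) f X = 0"
      if lm: "l \<in> paths G" "m \<in> paths G" "src G l = rng G m" for l m
    proof -
      have "l \<in> X" if "cmp G l m \<in> X" using bdry_prefix[OF X lm that] .
      moreover have "m \<in> unshift l X \<longleftrightarrow> cmp G l m \<in> X" using lm by (simp add: unshift_def)
      ultimately show ?thesis by (auto simp: evs unshift_cmp[OF lm])
    qed
    show "ev (T m * T l - T (cmp G l m)) f X = 0"
      if lm: "l \<in> paths G" "m \<in> paths G" "src G l = rng G m" for l m
    proof -
      have "src G l \<in> shift m X" if "src G m \<in> X"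
        using bdry_rng[OF bdry_shift[OF X lm(2) that] in_shift[OF lm(2) that]] lm(3) by simp
      then show ?thesis using lm by (auto simp: evs shift_cmp[OF X lm])
    qed
    show "l \<in> paths G \<Longrightarrow> ev (P (rng G l) * S l - S l) f X = 0" for l
      using bdry_rng[OF X] by (auto simp: evs)
    show "l \<in> paths G \<Longrightarrow> ev (S l * P (src G l) - S l) f X = 0" for l
      using src_in_unshift[OF X] by (auto simp: evs)
    show "l \<in> paths G \<Longrightarrow> ev (P (src G l) * T l - T l) f X = 0" for l
      by (auto simp: evs)
    show "l \<in> paths G \<Longrightarrow> ev (T l * P (rng G l) - T l) f X = 0" for l
      using bdry_rng[OF bdry_shift[OF X] in_shift, of l] by (auto simp: evs)
    show "ev (T l * S m - (if l = m then P (src G l) else 0)) f X = 0"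
      if lm: "in_Nk k n" "n \<noteq> 0" "l \<in> LE n" "m \<in> LE n" for n l m
    proof (cases "src G l \<in> X")
      case True
      have lX: "bdry (shift l X)" "l \<in> shift l X"
        using lm True X by (auto intro: bdry_shift in_shift)
      \<comment> \<open>If \<open>m\<close> is a segment too, then \<open>l\<close> and
        \<open>m\<close> are both the segment of \<open>shift l X\<close> in
        \<open>LE n\<close>.\<close>
      then have "m \<in> shift l X \<longleftrightarrow> l = m"
        using lm bdry_LE_unique[OF lX(1,2)] by blast
      then show ?thesis using lm True unshift_shift[OF X _ True] by (auto simp: evs)
    qed (use lm in \<open>auto simp: evs\<close>)
    show "ev (P v - (\<Sum>l\<in>{l \<in> LE n. rng G l = v}. S l * T l)) f X = 0"
      if v: "v \<in> verts G" "in_Nk k n" "n \<noteq> 0" for v n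
    proof -
      \<comment> \<open>\<open>l\<close> is the only segment of \<open>X\<close> in
        \<open>LE n\<close>, so at most one summand acts nontrivially; it occurs in the sum exactly
        when \<open>v\<close> is the range of \<open>X\<close>.\<close>
      obtain l where l: "l \<in> X" "l \<in> LE n" using bdry_LE[OF X v(2)] by blast
      have *: "ev (S m * T m) f X = (if m = l then f X else 0)" if "m \<in> LE n" for m
      proof (cases "m \<in> X")
        case True
        with bdry_LE_unique[OF X _ l(1) that l(2)] src_in_unshift[OF X True] shift_unshift[OF X True] that
        show ?thesis by (simp add: evs)
      next
        case False
        with l show ?thesis by (auto simp: evs)
      qed
      have "rng G l = v \<longleftrightarrow> v \<in> X"
        using bdry_vert[OF X _ v(1) l(1)] bdry_rng[OF X l(1)] by auto
      moreover have "(\<Sum>m\<in>{m \<in> LE n. rng G m = v}. ev (S m * T m) f X) =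
          (\<Sum>m\<in>{m \<in> LE n. rng G m = v}. if m = l then f X else 0)"
        by (intro sum.cong) (auto simp: *)
      ultimately show ?thesis
        using l finite_LE[OF v(2,1)] v(1) by (simp add: ev_linear ev_gen sum.delta')
    qed
  qed
qed

lemma K_null: "K \<subseteq> null"
  by (intro K_least uideal_null rel_null)

text \<open>At a boundary path with range \<open>v\<close> the constant function 1 is multiplied by
  \<open>c\<close>, while \<open>K\<close> acts as zero.\<close>

lemma scl_P_in_K:
  assumes "scl c (P v) \<in> K" "v \<in> verts G" shows "c = 0"
proof -
  from bdry_exists[OF assms(2)] obtain X where X: "bdry X" "v \<in> X" by blast
  from assms(1) K_null X(1) have "ev (scl c (P v)) (\<lambda>_. 1) X = 0"
    by (auto simp: null_def)
  with X assms(2) show ?thesis by (simp add: ev_linear ev_gen)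
qed

subsection \<open>Spanning sets and matrix units\<close>


definition eqK :: "('a, 'r) falg \<Rightarrow> ('a, 'r) falg \<Rightarrow> bool" (infix "\<approx>" 50) where
  "x \<approx> y \<longleftrightarrow> x - y \<in> K"

lemmas K_ideal = uidealD[OF uideal_K]

lemma eqK_refl [simp, intro]: "x \<approx> x"
  by (simp add: eqK_def K_ideal)
lemma eqK_sym: "x \<approx> y \<Longrightarrow> y \<approx> x"
  unfolding eqK_def using K_ideal(6)[OF K_ideal(1), of "x - y"] by simp
lemma eqK_trans [trans]: "x \<approx> y \<Longrightarrow> y \<approx> z \<Longrightarrow> x \<approx> z"
  unfolding eqK_def using K_ideal(2)[of "x - y" "y - z"] by simp
lemma eqK_add: "x \<approx> y \<Longrightarrow> x' \<approx> y' \<Longrightarrow> x + x' \<approx> y + y'"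
  unfolding eqK_def using K_ideal(2)[of "x - y" "x' - y'"] by (simp add: algebra_simps)
lemma eqK_scl: "x \<approx> y \<Longrightarrow> scl c x \<approx> scl c y"
  unfolding eqK_def using K_ideal(3)[of "x - y" c] by (simp add: scl_diff)
lemma eqK_mult: "x \<approx> y \<Longrightarrow> x' \<approx> y' \<Longrightarrow> x * x' \<approx> y * y'"
  unfolding eqK_def
  using K_ideal(2)[OF K_ideal(5)[of "x - y" x'] K_ideal(4)[of "x' - y'" y]] by (simp add: algebra_simps)
lemma eqK_mult1: "x \<approx> y \<Longrightarrow> x * z \<approx> y * z"
  by (rule eqK_mult) simp_all
lemma eqK_mult2: "x \<approx> y \<Longrightarrow> z * x \<approx> z * y"
  by (rule eqK_mult) simp_all
lemma eqK_sum: "(\<And>i. i \<in> A \<Longrightarrow> f i \<approx> g i) \<Longrightarrow> sum f A \<approx> sum g A"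
  by (induction A rule: infinite_finite_induct) (auto intro: eqK_add)
lemma eqK_0: "x \<approx> 0 \<longleftrightarrow> x \<in> K"
  by (simp add: eqK_def)
lemma eqK_mem: "uideal I \<Longrightarrow> K \<subseteq> I \<Longrightarrow> x \<approx> y \<Longrightarrow> x \<in> I \<longleftrightarrow> y \<in> I"
  unfolding eqK_def using uidealD(2)[of I "x - y" y] uidealD(6)[of I x "x - y"] by auto
lemmas eqK_memK = eqK_mem[OF uideal_K subset_refl]

lemma eq_rel: "x - y \<in> rel \<Longrightarrow> x \<approx> y"
  unfolding eqK_def by (rule rel_K)

lemmas P_P = rel.PP[THEN eq_rel] and S_S = rel.SS[THEN eq_rel] and T_T = rel.TT[THEN eq_rel]
  and P_S = rel.PS[THEN eq_rel] and S_P = rel.SP[THEN eq_rel]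
  and P_T = rel.PT[THEN eq_rel] and T_P = rel.TP[THEN eq_rel]
  and S_v = rel.S_vert[THEN eq_rel] and T_v = rel.T_vert[THEN eq_rel]

text \<open>(KP3) including degree zero, where \<open>LE 0\<close> consists of the vertices and
  (KP1) gives the claim. Later bounds are degrees of arbitrary paths, hence possibly zero.\<close>

lemma T_S:
  assumes n: "in_Nk k n" and l: "l \<in> LE n" and m: "m \<in> LE n"
  shows "T l * S m \<approx> (if l = m then P (src G l) else 0)"
proof (cases "n = 0")
  case True
  then have v: "l \<in> verts G" "m \<in> verts G" using l m by simp_all
  have "T l * S m \<approx> P l * P m" by (intro eqK_mult T_v S_v v)
  also have "\<dots> \<approx> (if l = m then P l else 0)" by (rule P_P[OF v])
  finally show ?thesis using v by (cases "l = m") simp_all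
qed (use assms rel.TS[THEN eq_rel] in blast)

lemma P_sum:
  assumes v: "v \<in> verts G" and n: "in_Nk k n"
  shows "P v \<approx> (\<Sum>l\<in>{l \<in> LE n. rng G l = v}. S l * T l)"
proof (cases "n = 0")
  case True
  then have "{l \<in> LE n. rng G l = v} = {v}" using v vertsD(3) by auto
  moreover have "S v * T v \<approx> P v * P v" by (intro eqK_mult T_v S_v v)
  then have "S v * T v \<approx> P v" using P_P[OF v v] by (auto intro: eqK_trans)
  ultimately show ?thesis by (auto intro: eqK_sym)
qed (use assms rel.ST[THEN eq_rel] in blast)

lemma T_S_self: "l \<in> paths G \<Longrightarrow> T l * S l \<approx> P (src G l)"
  using T_S[of "deg G l" l l] LE_deg by simp

lemma P_S0: "l \<in> paths G \<Longrightarrow> v \<noteq> rng G l \<Longrightarrow> P v * S l \<in> K"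
proof (cases "v \<in> verts G")
  case False
  then show ?thesis using rel_K[OF rel.P_out] by (intro K_ideal(5))
next
  case True
  assume l: "l \<in> paths G" "v \<noteq> rng G l"
  have "P v * S l \<approx> P v * (P (rng G l) * S l)" using l P_S by (blast intro: eqK_mult2 eqK_sym)
  also have "\<dots> = P v * P (rng G l) * S l" by (simp add: mult.assoc)
  also have "\<dots> \<approx> 0 * S l" using P_P[OF True, of "rng G l"] l by (intro eqK_mult1) simp
  finally show ?thesis by (simp add: eqK_0)
qed

lemma T_P0: "l \<in> paths G \<Longrightarrow> v \<noteq> rng G l \<Longrightarrow> T l * P v \<in> K"
proof (cases "v \<in> verts G")
  case False
  then show ?thesis using rel_K[OF rel.P_out] by (intro K_ideal(4))
next
  case True
  assume l: "l \<in> paths G" "v \<noteq> rng G l"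
  have "T l * P v \<approx> T l * P (rng G l) * P v" using l T_P by (blast intro: eqK_mult1 eqK_sym)
  also have "\<dots> = T l * (P (rng G l) * P v)" by (simp add: mult.assoc)
  also have "\<dots> \<approx> T l * 0" using P_P[OF _ True, of "rng G l"] l by (intro eqK_mult2) simp
  finally show ?thesis by (simp add: eqK_0)
qed

lemma S_S0: 
  assumes "l \<in> paths G" "m \<in> paths G" "src G l \<noteq> rng G m" shows "S l * S m \<in> K"
proof -
  have "S l * S m \<approx> S l * P (src G l) * S m" using assms S_P by (blast intro: eqK_mult1 eqK_sym)
  moreover have "S l * P (src G l) * S m \<in> K"
    unfolding mult.assoc using assms by (intro K_ideal(4) P_S0)
  ultimately show ?thesis using eqK_memK by blast
qed

lemma ST_mid: "a \<in> paths G \<Longrightarrow> S a * T b \<approx> S a * P (src G a) * T b"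
  using S_P by (blast intro: eqK_mult1 eqK_sym)

lemma S_expand:
  assumes a: "a \<in> paths G" and n: "in_Nk k n"
  shows "S a \<approx> (\<Sum>c\<in>{c \<in> LE n. rng G c = src G a}. S (cmp G a c) * T c)"
proof -
  let ?C = "{c \<in> LE n. rng G c = src G a}"
  have "S a \<approx> S a * P (src G a)" using S_P[OF a] by (rule eqK_sym)
  also have "\<dots> \<approx> S a * (\<Sum>c\<in>?C. S c * T c)" using a by (intro eqK_mult2 P_sum n) simp
  also have "\<dots> = (\<Sum>c\<in>?C. S a * S c * T c)" by (simp add: sum_distrib_left mult.assoc)
  also have "\<dots> \<approx> (\<Sum>c\<in>?C. S (cmp G a c) * T c)"
    using a by (intro eqK_sum eqK_mult1 S_S) auto
  finally show ?thesis .
qed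

lemma T_expand:
  assumes b: "b \<in> paths G" and n: "in_Nk k n"
  shows "T b \<approx> (\<Sum>c\<in>{c \<in> LE n. rng G c = src G b}. S c * T (cmp G b c))"
proof -
  let ?C = "{c \<in> LE n. rng G c = src G b}"
  have "T b \<approx> P (src G b) * T b" using P_T[OF b] by (rule eqK_sym)
  also have "\<dots> \<approx> (\<Sum>c\<in>?C. S c * T c) * T b" using b by (intro eqK_mult1 P_sum n) simp
  also have "\<dots> = (\<Sum>c\<in>?C. S c * (T c * T b))" by (simp add: sum_distrib_right mult.assoc)
  also have "\<dots> \<approx> (\<Sum>c\<in>?C. S c * T (cmp G b c))"
    using b by (intro eqK_sum eqK_mult2 T_T) auto
  finally show ?thesis .
qed

lemma ST_expand:
  assumes ab: "a \<in> paths G" "b \<in> paths G" "src G a = src G b" and n: "in_Nk k n"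
  shows "S a * T b \<approx> (\<Sum>c\<in>{c \<in> LE n. rng G c = src G a}. S (cmp G a c) * T (cmp G b c))"
proof -
  let ?C = "{c \<in> LE n. rng G c = src G a}"
  have "S a * T b \<approx> (\<Sum>c\<in>?C. S (cmp G a c) * T c) * T b"
    by (intro eqK_mult1 S_expand ab n)
  also have "\<dots> = (\<Sum>c\<in>?C. S (cmp G a c) * (T c * T b))" by (simp add: sum_distrib_right mult.assoc)
  also have "\<dots> \<approx> (\<Sum>c\<in>?C. S (cmp G a c) * T (cmp G b c))"
    using ab by (intro eqK_sum eqK_mult2 T_T) auto
  finally show ?thesis .
qed

text \<open>\<open>K\<close> is included so that membership depends only on the class modulo the
  relations. \<open>Q\<close> will be a condition on the difference of degrees or on the common
  source.\<close>

inductive_set pspan :: "('a \<Rightarrow> 'a \<Rightarrow> bool) \<Rightarrow> ('a, 'r) falg set" for Q where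
  pspan_K: "x \<in> K \<Longrightarrow> x \<in> pspan Q"
| pspan_ST: "a \<in> paths G \<Longrightarrow> b \<in> paths G \<Longrightarrow> src G a = src G b \<Longrightarrow> Q a b \<Longrightarrow> scl c (S a * T b) \<in> pspan Q"
| pspan_add: "x \<in> pspan Q \<Longrightarrow> y \<in> pspan Q \<Longrightarrow> x + y \<in> pspan Q"

lemma pspan_scl: "x \<in> pspan Q \<Longrightarrow> scl c x \<in> pspan Q"
proof (induction rule: pspan.induct)
  case (pspan_ST a b d)
  then show ?case using pspan.pspan_ST[of a b Q "c * d"] by simp
qed (auto simp: scl_add intro: pspan_add pspan.pspan_K K_ideal)

lemma pspan_sum: "(\<And>i. i \<in> A \<Longrightarrow> f i \<in> pspan Q) \<Longrightarrow> sum f A \<in> pspan Q"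
  by (induction A rule: infinite_finite_induct) (auto intro: pspan.intros K_ideal)

lemma pspan_eq: "x \<approx> y \<Longrightarrow> y \<in> pspan Q \<Longrightarrow> x \<in> pspan Q"
  using pspan_add[OF pspan_K[where Q = Q, of "x - y"], of y] by (simp add: eqK_def)

lemma pspan_ST1: "a \<in> paths G \<Longrightarrow> b \<in> paths G \<Longrightarrow> src G a = src G b \<Longrightarrow> Q a b \<Longrightarrow> S a * T b \<in> pspan Q"
  using pspan_ST[of a b Q 1] by simp

section \<open>Degrees of words and of spanning elements\<close>

abbreviation dd :: "(nat \<Rightarrow> int) \<Rightarrow> 'a \<Rightarrow> 'a \<Rightarrow> bool" where
  "dd n a b \<equiv> \<forall>i. int (deg G a i) - int (deg G b i) = n i"

fun gdeg :: "'a gen \<Rightarrow> nat \<Rightarrow> int" where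
  "gdeg (Pg v) = 0"
| "gdeg (Sg l) = (if l \<in> paths G then \<lambda>i. int (deg G l i) else 0)"
| "gdeg (Tg l) = (if l \<in> paths G then \<lambda>i. - int (deg G l i) else 0)"

definition wdeg :: "'a gen list \<Rightarrow> nat \<Rightarrow> int" where
  "wdeg w = sum_list (map gdeg w)"

lemma wdeg_simps [simp]: "wdeg [] = 0" "wdeg (u @ v) = wdeg u + wdeg v" "wdeg [g] = gdeg g" "wdeg (g # w) = gdeg g + wdeg w"
  by (simp_all add: wdeg_def)

text \<open>(KP3) does not apply to \<open>T l * S a\<close> directly. Prolonging \<open>l\<close>
  by \<open>LE (deg G a)\<close> and \<open>a\<close> by \<open>LE (deg G l)\<close> brings both
  into \<open>LE (deg G l + deg G a)\<close>; the terms with \<open>cmp G l c = cmp G a d\<close>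
  survive as \<open>S c * T (cmp G b d)\<close>, and comparing degrees in this equation gives the
  condition.\<close>

lemma T_ST_pspan:
  assumes l: "l \<in> paths G" and ab: "a \<in> paths G" "b \<in> paths G" "src G a = src G b"
  shows "T l * (S a * T b) \<in> pspan (\<lambda>c d. \<forall>i. int (deg G c i) - int (deg G d i) =
           int (deg G a i) - int (deg G b i) - int (deg G l i))" (is "_ \<in> pspan ?Q")
proof -
  let ?m = "deg G l + deg G a"
  let ?C = "{c \<in> LE (deg G a). rng G c = src G l}"
  let ?D = "{d \<in> LE (deg G l). rng G d = src G a}"
  have "T l * (S a * T b) \<approx> (\<Sum>c\<in>?C. S c * T (cmp G l c)) * ((\<Sum>d\<in>?D. S (cmp G a d) * T d) * T b)"
    using l ab by (intro eqK_mult T_expand S_expand) simp_all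
  also have "\<dots> = (\<Sum>c\<in>?C. \<Sum>d\<in>?D. S c * (T (cmp G l c) * S (cmp G a d)) * (T d * T b))"
    by (simp add: sum_distrib_left sum_distrib_right mult.assoc)
       (rule sum.swap)
  finally show ?thesis
  proof (rule pspan_eq, intro pspan_sum)
    fix c d assume "c \<in> ?C" "d \<in> ?D"
    then have c: "c \<in> LE (deg G a)" "rng G c = src G l" and d: "d \<in> LE (deg G l)" "rng G d = src G a" by auto
    have lc: "cmp G l c \<in> LE ?m" using LE_cmp[OF l c(1)] c(2) by simp
    have ad: "cmp G a d \<in> LE ?m" using LE_cmp[OF ab(1) d(1)] d(2) by (simp add: add.commute)
    have TT: "T d * T b \<approx> T (cmp G b d)" using d ab by (intro T_T) auto
    have "S c * (T (cmp G l c) * S (cmp G a d)) * (T d * T b)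
        \<approx> S c * (if cmp G l c = cmp G a d then P (src G (cmp G l c)) else 0) * T (cmp G b d)"
      using l ab by (intro eqK_mult TT eqK_refl T_S[OF _ lc ad]) simp
    also have "\<dots> \<in> pspan ?Q"
    proof (cases "cmp G l c = cmp G a d")
      case True
      have s: "src G c = src G d"
        using arg_cong[OF True, of "src G"] l ab c d by simp
      have dg: "deg G l + deg G c = deg G a + deg G d"
        using arg_cong[OF True, of "deg G"] l ab c d by simp
      have Q: "?Q c (cmp G b d)"
      proof
        fix i
        have "deg G l i + deg G c i = deg G a i + deg G d i" using fun_cong[OF dg, of i] by simp
        then show "int (deg G c i) - int (deg G (cmp G b d) i) =
           int (deg G a i) - int (deg G b i) - int (deg G l i)"
          using ab d by simp
      qed
      have "S c * P (src G c) * T (cmp G b d) \<in> pspan ?Q"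
        by (rule pspan_eq[OF eqK_mult1[OF S_P] pspan_ST1]) (use c d s ab Q in simp_all)
      moreover have "src G (cmp G l c) = src G c" using l c by simp
      ultimately show ?thesis using True by simp
    next
      case False
      then show ?thesis by (simp add: pspan_K K_ideal)
    qed
    finally (pspan_eq) show "S c * (T (cmp G l c) * S (cmp G a d)) * (T d * T b) \<in> pspan ?Q" .
  qed
qed

lemma gen_ST_pspan:
  assumes ab: "a \<in> paths G" "b \<in> paths G" "src G a = src G b" and n: "dd n a b"
  shows "mon [g] * (S a * T b) \<in> pspan (dd (gdeg g + n))"
proof (cases g)
  case (Pg v)
  show ?thesis
  proof (cases "v = rng G a")
    case True
    have "P v * S a * T b \<in> pspan (dd n)"
      unfolding True by (rule pspan_eq[OF eqK_mult1[OF P_S] pspan_ST1]) (use ab n in auto)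
    with Pg show ?thesis by (simp add: mult.assoc)
  next
    case False
    then show ?thesis using P_S0[OF ab(1) False] Pg by (auto simp flip: mult.assoc intro: pspan_K K_ideal)
  qed
next
  case (Sg l)
  consider "l \<notin> paths G" | "l \<in> paths G" "src G l \<noteq> rng G a" | "l \<in> paths G" "src G l = rng G a" by blast
  then show ?thesis
  proof cases
    case 1
    then show ?thesis unfolding Sg by (intro pspan_K K_ideal(5) rel_K rel.S_out)
  next
    case 2
    then show ?thesis using S_S0[OF 2(1) ab(1) 2(2)] Sg by (auto simp flip: mult.assoc intro: pspan_K K_ideal)
  next
    case 3
    have "S l * S a * T b \<in> pspan (dd (gdeg g + n))"
      by (rule pspan_eq[OF eqK_mult1[OF S_S] pspan_ST1]) (use ab n 3 Sg in \<open>auto simp flip: n[rule_format]\<close>)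
    then show ?thesis unfolding Sg by (simp add: mult.assoc)
  qed
next
  case (Tg l)
  show ?thesis
  proof (cases "l \<in> paths G")
    case False
    then show ?thesis unfolding Tg by (intro pspan_K K_ideal(5) rel_K rel.T_out)
  next
    case True
    have "(\<lambda>i. int (deg G a i) - int (deg G b i) - int (deg G l i)) = gdeg g + n"
      using n Tg True by (auto simp: fun_eq_iff)
    with T_ST_pspan[OF True ab] Tg show ?thesis by (simp add: fun_eq_iff)
  qed
qed

lemma gen_pspan:
  assumes "x \<in> pspan (dd n)" shows "mon [g] * x \<in> pspan (dd (gdeg g + n))"
  using assms
proof (induction rule: pspan.induct)
  case (pspan_ST a b c)
  then have "scl c (mon [g] * (S a * T b)) \<in> pspan (dd (gdeg g + n))"
    by (intro pspan_scl gen_ST_pspan)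
  moreover have "mon [g] * scl c (S a * T b) = scl c (mon [g] * (S a * T b))" by simp
  ultimately show ?case by (simp only:)
qed (auto simp: distrib_left intro: pspan.intros K_ideal)

text \<open>Modulo \<open>K\<close> the single letters are \<open>S v * T v\<close>,
  \<open>S l * T (src G l)\<close> and \<open>S (src G l) * T l\<close>; further letters are
  multiplied from the left. The empty word is the adjoined unit and is excluded.\<close>

lemma mon_pspan: "w \<noteq> [] \<Longrightarrow> mon w \<in> pspan (dd (wdeg w))"
proof (induction w)
  case (Cons g w)
  show ?case
  proof (cases "w = []")
    case False
    have "mon (g # w) = (mon [g] * mon w :: ('a, 'r) falg)"
      using mon_append[of "[g]" w] by simp
    with gen_pspan[OF Cons.IH[OF False], of g] show ?thesis by simp
  next
    case True
    have "mon [g] \<in> pspan (dd (gdeg g))"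
    proof (cases g)
      case (Pg v)
      show ?thesis
      proof (cases "v \<in> verts G")
        case v: True
        have "P v \<approx> P v * P v" using P_P[OF v v] by (simp add: eqK_sym)
        also have "\<dots> \<approx> S v * T v" by (intro eqK_mult eqK_sym[OF S_v] eqK_sym[OF T_v] v)
        finally show ?thesis unfolding Pg by (rule pspan_eq) (intro pspan_ST1; use v in simp)
      qed (auto simp: Pg intro: pspan_K rel_K rel.intros)
    next
      case (Sg l)
      show ?thesis
      proof (cases "l \<in> paths G")
        case l: True
        have "S l \<approx> S l * P (src G l)" using S_P[OF l] by (rule eqK_sym)
        also have "\<dots> \<approx> S l * T (src G l)" using l by (intro eqK_mult2 eqK_sym[OF T_v]) simp
        finally show ?thesis unfolding Sg by (rule pspan_eq) (intro pspan_ST1; use l in simp)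
      qed (auto simp: Sg intro: pspan_K rel_K rel.intros)
    next
      case (Tg l)
      show ?thesis
      proof (cases "l \<in> paths G")
        case l: True
        have "T l \<approx> P (src G l) * T l" using P_T[OF l] by (rule eqK_sym)
        also have "\<dots> \<approx> S (src G l) * T l" using l by (intro eqK_mult1 eqK_sym[OF S_v]) simp
        finally show ?thesis unfolding Tg by (rule pspan_eq) (intro pspan_ST1; use l in simp)
      qed (auto simp: Tg intro: pspan_K rel_K rel.intros)
    qed
    with True show ?thesis by (simp add: wdeg_def)
  qed
qed simp

section \<open>Normal forms and their coefficients\<close>

definition nf :: "('a \<times> 'a) set \<Rightarrow> ('a, 'r) falg \<Rightarrow> bool" where
  "nf B x \<longleftrightarrow> (\<exists>F c. finite F \<and> F \<subseteq> B \<and> x \<approx> (\<Sum>p\<in>F. scl (c p) (S (fst p) * T (snd p))))"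

lemma nf_K: "x \<in> K \<Longrightarrow> nf B x"
  unfolding nf_def by (intro exI[of _ "{}"]) (simp add: eqK_0)

text \<open>Coefficients of pairs common to both sums are merged, so that every pair keeps a single
  coefficient; \<open>nf_coefficient\<close> relies on this.\<close>

lemma nf_add:
  assumes "nf B x" "nf B y" shows "nf B (x + y)"
proof -
  let ?e = "\<lambda>p. S (fst p) * T (snd p)"
  from assms obtain F c F' c' where F: "finite F" "F \<subseteq> B" "x \<approx> (\<Sum>p\<in>F. scl (c p) (?e p))"
    "finite F'" "F' \<subseteq> B" "y \<approx> (\<Sum>p\<in>F'. scl (c' p) (?e p))" unfolding nf_def by blast
  let ?d = "\<lambda>p. if p \<in> F then c p else 0" and ?d' = "\<lambda>p. if p \<in> F' then c' p else 0"
  have "(\<Sum>p\<in>F. scl (c p) (?e p)) = (\<Sum>p\<in>F \<union> F'. scl (?d p) (?e p))"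
    using F by (intro sum.mono_neutral_cong_left) auto
  moreover have "(\<Sum>p\<in>F'. scl (c' p) (?e p)) = (\<Sum>p\<in>F \<union> F'. scl (?d' p) (?e p))"
    using F by (intro sum.mono_neutral_cong_left) auto
  ultimately have "x + y \<approx> (\<Sum>p\<in>F \<union> F'. scl (?d p + ?d' p) (?e p))"
    using eqK_add[OF F(3,6)] by (simp only: scl_add_left sum.distrib)
  with F show ?thesis unfolding nf_def by (intro exI[of _ "F \<union> F'"] exI[of _ "\<lambda>p. ?d p + ?d' p"]) auto
qed

lemma pspan_nf: "x \<in> pspan Q \<Longrightarrow> nf {(a, b). a \<in> paths G \<and> b \<in> paths G \<and> src G a = src G b \<and> Q a b} x"
proof (induction rule: pspan.induct)
  case (pspan_ST a b c)
  then show ?case unfolding nf_def by (intro exI[of _ "{(a, b)}"] exI[of _ "\<lambda>_. c"]) auto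
qed (auto intro: nf_K nf_add)

abbreviation BLE :: "(nat \<Rightarrow> nat) \<Rightarrow> (nat \<Rightarrow> nat) \<Rightarrow> ('a \<times> 'a) set" where
  "BLE m m' \<equiv> {(a, b). a \<in> LE m \<and> b \<in> LE m' \<and> src G a = src G b}"

text \<open>By cancellation the pairs \<open>(cmp G a c, cmp G b c)\<close> are distinct, so the
  expansion over \<open>LE n\<close> is already a normal form, with constant coefficient.\<close>

lemma nf_ST:
  assumes ab: "a \<in> paths G" "b \<in> paths G" "src G a = src G b" and n: "in_Nk k n"
  shows "nf (BLE (deg G a + n) (deg G b + n)) (scl c (S a * T b))"
proof -
  let ?C = "{c \<in> LE n. rng G c = src G a}" and ?f = "\<lambda>c. (cmp G a c, cmp G b c)"
  have inj: "inj_on ?f ?C"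
  proof (rule inj_onI)
    fix x y assume "x \<in> ?C" "y \<in> ?C" "?f x = ?f y"
    with ab show "x = y" by (intro cmp_inject(2)[of a x a y]) auto
  qed
  have "scl c (S a * T b) \<approx> scl c (\<Sum>c\<in>?C. S (cmp G a c) * T (cmp G b c))"
    by (intro eqK_scl ST_expand ab n)
  also have "\<dots> = (\<Sum>p\<in>?f ` ?C. scl c (S (fst p) * T (snd p)))"
    by (simp only: sum.reindex[OF inj] scl_sum) simp
  finally have *: "scl c (S a * T b) \<approx> (\<Sum>p\<in>?f ` ?C. scl c (S (fst p) * T (snd p)))" .
  have "?f ` ?C \<subseteq> BLE (deg G a + n) (deg G b + n)"
    using ab by (auto intro!: LE_cmp)
  with * show ?thesis unfolding nf_def
    using finite_LE[OF n, of "src G a"] ab by (intro exI[of _ "?f ` ?C"] exI[of _ "\<lambda>_. c"]) simp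
qed

text \<open>The claim is made for all large bounds rather than for one, so that two summands can be
  brought to the same pair of bounds.\<close>

lemma pspan_nf_BLE_eventually:
  assumes "x \<in> pspan (dd n)"
  shows "\<exists>m0. in_Nk k m0 \<and> (\<forall>m m'. in_Nk k m \<longrightarrow> m0 \<le> m \<longrightarrow>
    (\<forall>i. int (m i) - int (m' i) = n i) \<longrightarrow> nf (BLE m m') x)"
  using assms
proof (induction rule: pspan.induct)
  case (pspan_K x)
  then show ?case by (intro exI[of _ "0 :: nat \<Rightarrow> nat"]) (simp add: nf_K in_Nk_def)
next
  case (pspan_ST a b c)
  show ?case
  proof (intro exI[of _ "deg G a"] conjI allI impI)
    fix m m' assume m: "in_Nk k m" "deg G a \<le> m" "\<forall>i. int (m i) - int (m' i) = n i"
    have i: "deg G a i \<le> m i" "int (m i) - int (m' i) = int (deg G a i) - int (deg G b i)" for i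
      using m pspan_ST(4) by (auto simp: le_fun_def)
    have "m = deg G a + (m - deg G a)" using i by (auto simp: fun_eq_iff)
    \<comment> \<open>Both differences of degrees equal \<open>n\<close>, so the amount that lifts
      \<open>deg G a\<close> to \<open>m\<close> also lifts \<open>deg G b\<close> to
      \<open>m'\<close>.\<close>
    moreover have "m' = deg G b + (m - deg G a)"
    proof
      fix j show "m' j = (deg G b + (m - deg G a)) j" using i[of j] by simp
    qed
    moreover have "in_Nk k (m - deg G a)" using m by simp
    ultimately show "nf (BLE m m') (scl c (S a * T b))"
      using nf_ST[OF pspan_ST(1-3), of "m - deg G a" c] by simp
  qed (use pspan_ST in simp)
next
  case (pspan_add x y)
  then obtain m0 m1 where m: "in_Nk k m0" "in_Nk k m1"
    "\<And>m m'. in_Nk k m \<Longrightarrow> m0 \<le> m \<Longrightarrow> \<forall>i. int (m i) - int (m' i) = n i \<Longrightarrow> nf (BLE m m') x"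
    "\<And>m m'. in_Nk k m \<Longrightarrow> m1 \<le> m \<Longrightarrow> \<forall>i. int (m i) - int (m' i) = n i \<Longrightarrow> nf (BLE m m') y"
    by blast
  show ?case
  proof (intro exI[of _ "m0 + m1"] conjI allI impI)
    fix m m' assume *: "in_Nk k m" "m0 + m1 \<le> m" "\<forall>i. int (m i) - int (m' i) = n i"
    have "m0 \<le> m" "m1 \<le> m" using *(2) by (auto simp: le_fun_def intro: add_leD1 add_leD2)
    with m * show "nf (BLE m m') (x + y)" by (intro nf_add) blast+
  qed (use m in \<open>simp add: in_Nk_def\<close>)
qed

lemma pspan_nf_BLE:
  assumes x: "x \<in> pspan (dd n)"
  obtains m m' where "in_Nk k m" "in_Nk k m'" "nf (BLE m m') x"
proof (cases "\<forall>i\<ge>k. n i = 0")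
  case True
  from pspan_nf_BLE_eventually[OF x] obtain m0 where m0: "in_Nk k m0"
    "\<And>m m'. in_Nk k m \<Longrightarrow> m0 \<le> m \<Longrightarrow> \<forall>i. int (m i) - int (m' i) = n i \<Longrightarrow> nf (BLE m m') x"
    by blast
  \<comment> \<open>Adding the positive and the negative part of \<open>n\<close> to
    \<open>m0\<close> gives bounds in the natural numbers whose difference is
    \<open>n\<close>.\<close>
  let ?m = "\<lambda>i. m0 i + nat (n i)" and ?m' = "\<lambda>i. m0 i + nat (- n i)"
  have "in_Nk k ?m" "in_Nk k ?m'" using m0(1) True by (auto simp: in_Nk_def)
  moreover from this have "nf (BLE ?m ?m') x" by (intro m0(2)) (auto simp: le_fun_def)
  ultimately show ?thesis by (rule that)
next
  case False
  then obtain i where i: "i \<ge> k" "n i \<noteq> 0" by blast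
  \<comment> \<open>Degrees of paths vanish from index \<open>k\<close> on, so no
    \<open>S a * T b\<close> has such a degree and only \<open>K\<close> remains.\<close>
  have "x \<in> K" using x
  proof (induction rule: pspan.induct)
    case (pspan_ST a b c)
    then have "deg G a i = 0" "deg G b i = 0"
      using i(1) path_simps(11)[of a] path_simps(11)[of b] by (auto simp: in_Nk_def)
    with pspan_ST(4) i(2) show ?case by (metis diff_self of_nat_0)
  qed (auto intro: K_ideal)
  then show ?thesis using that[of 0 0] by (simp add: nf_K)
qed

text \<open>\<open>T_S\<close> for the bound \<open>m\<close> on the left and for \<open>m'\<close>
  on the right annihilates every term except that of \<open>(a, b)\<close>.\<close>

lemma nf_coefficient:
  assumes m: "in_Nk k m" "in_Nk k m'" and F: "finite F" "F \<subseteq> BLE m m'"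
    and x: "x \<approx> (\<Sum>p\<in>F. scl (c p) (S (fst p) * T (snd p)))" and ab: "(a, b) \<in> F"
  shows "T a * x * S b \<approx> scl (c (a, b)) (P (src G a))"
proof -
  have ab': "a \<in> LE m" "b \<in> LE m'" "src G a = src G b" using F ab by auto
  have "T a * x * S b \<approx> T a * (\<Sum>p\<in>F. scl (c p) (S (fst p) * T (snd p))) * S b"
    by (intro eqK_mult1 eqK_mult2 x)
  also have "\<dots> = (\<Sum>p\<in>F. scl (c p) (T a * S (fst p) * (T (snd p) * S b)))"
    by (simp add: sum_distrib_left sum_distrib_right mult.assoc)
  also have "\<dots> \<approx> (\<Sum>p\<in>F. if p = (a, b) then scl (c p) (P (src G a)) else 0)"
  proof (rule eqK_sum)
    fix p assume "p \<in> F"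
    then obtain a' b' where p: "p = (a', b')" "a' \<in> LE m" "b' \<in> LE m'" using F by auto
    have "T a * S a' * (T b' * S b) \<approx> (if a = a' then P (src G a) else 0) * (if b' = b then P (src G b') else 0)"
      by (rule eqK_mult[OF T_S[OF m(1) ab'(1) p(2)] T_S[OF m(2) p(3) ab'(2)]])
    also have "\<dots> \<approx> (if p = (a, b) then P (src G a) else 0)"
      using p(1) ab' P_P[of "src G a" "src G a"] by auto
    finally have "scl (c p) (T a * S a' * (T b' * S b)) \<approx> scl (c p) (if p = (a, b) then P (src G a) else 0)"
      by (rule eqK_scl)
    then show "scl (c p) (T a * S (fst p) * (T (snd p) * S b)) \<approx> (if p = (a, b) then scl (c p) (P (src G a)) else 0)"
      using p(1) by (cases "p = (a, b)") auto
  qed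
  also have "\<dots> = scl (c (a, b)) (P (src G a))" using F ab by simp
  finally show ?thesis .
qed

text \<open>The hypothesis speaks only of the scalars delivered by \<open>nf_coefficient\<close>, so
  that ideals and annihilators can be treated alike.\<close>

lemma pspan_restrict:
  assumes x: "x \<in> pspan (dd n)"
    and V: "\<And>a b c. a \<in> paths G \<Longrightarrow> b \<in> paths G \<Longrightarrow> src G a = src G b \<Longrightarrow>
      T a * x * S b \<approx> scl c (P (src G a)) \<Longrightarrow> c = 0 \<or> src G a \<in> V"
  shows "x \<in> pspan (\<lambda>a b. src G a \<in> V)"
proof -
  from x obtain m m' where m: "in_Nk k m" "in_Nk k m'" "nf (BLE m m') x" by (rule pspan_nf_BLE)
  then obtain F c where F: "finite F" "F \<subseteq> BLE m m'" "x \<approx> (\<Sum>p\<in>F. scl (c p) (S (fst p) * T (snd p)))"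
    unfolding nf_def by blast
  from F(3) show ?thesis
  proof (rule pspan_eq, intro pspan_sum)
    fix p assume p: "p \<in> F"
    obtain a b where ab: "p = (a, b)" by (cases p)
    then have LE: "a \<in> LE m" "b \<in> LE m'" "src G a = src G b" using F p by auto
    have "c p = 0 \<or> src G a \<in> V"
      using nf_coefficient[OF m(1,2) F, of a b] V[of a b "c p"] LE p ab by simp
    then show "scl (c p) (S (fst p) * T (snd p)) \<in> pspan (\<lambda>a b. src G a \<in> V)"
      using pspan_ST[of a b _ "c p"] pspan_K[OF K_ideal(1)] LE ab by (cases "c p = 0") simp_all
  qed
qed

subsection \<open>The grading\<close>


text \<open>Components are taken in the free algebra, by degrees of words; \<open>homc_K\<close>
  shows that they pass to the quotient.\<close>

abbreviation homc :: "(nat \<Rightarrow> int) \<Rightarrow> ('a, 'r) falg \<Rightarrow> ('a, 'r) falg" where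
  "homc n \<equiv> proj (\<lambda>w. wdeg w = n)"

lemma homc_mult_mon: "homc n (x * mon u) = homc (n - wdeg u) x * mon u"
proof (induction x rule: falg_induct)
  case (add c w x)
  have "wdeg w + wdeg u = n \<longleftrightarrow> wdeg w = n - wdeg u" by (auto simp: fun_eq_iff algebra_simps)
  with add show ?case
    by (simp add: distrib_right proj_linear proj_mon fun_diff_def flip: mon_append)
qed (simp add: proj_linear)

lemma homc_mon_mult: "homc n (mon u * x) = mon u * homc (n - wdeg u) x"
proof (induction x rule: falg_induct)
  case (add c w x)
  have "wdeg u + wdeg w = n \<longleftrightarrow> wdeg w = n - wdeg u" by (auto simp: fun_eq_iff algebra_simps)
  with add show ?case
    by (simp add: distrib_left proj_linear proj_mon fun_diff_def flip: mon_append)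
qed (simp add: proj_linear)

lemma homc_sum:
  assumes "finite N" "wdeg ` {w. coef x w \<noteq> 0} \<subseteq> N" shows "(\<Sum>n\<in>N. homc n x) = x"
proof (rule coef_inject[THEN iffD1], rule ext)
  fix w
  have "coef (\<Sum>n\<in>N. homc n x) w = (\<Sum>n\<in>N. if n = wdeg w then coef x w else 0)"
    unfolding coef_sum fsum_def proj.rep_eq by (intro sum.cong) auto
  also have "\<dots> = coef x w" using assms by (auto simp: sum.delta)
  finally show "coef (\<Sum>n\<in>N. homc n x) w = coef x w" .
qed

lemma homc_pspan:
  assumes "coef x [] = 0" shows "homc n x \<in> pspan (dd n)"
proof -
  have "homc n x = (\<Sum>w\<in>{w. coef x w \<noteq> 0}. scl (coef x w) (homc n (mon w)))"
    by (subst falg_expand[of x]) (simp add: proj_sum proj_linear)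
  also have "\<dots> \<in> pspan (dd n)"
  proof (intro pspan_sum pspan_scl)
    fix w assume "w \<in> {w. coef x w \<noteq> 0}"
    with assms have "w \<noteq> []" by auto
    from mon_pspan[OF this] show "homc n (mon w) \<in> pspan (dd n)"
      by (auto simp: proj_mon intro: pspan_K K_ideal)
  qed
  finally show ?thesis .
qed

definition homog :: "(nat \<Rightarrow> int) \<Rightarrow> ('a, 'r) falg \<Rightarrow> bool" where
  "homog n x \<longleftrightarrow> (\<forall>w. coef x w \<noteq> 0 \<longrightarrow> wdeg w = n)"

lemma homog_intros:
  "wdeg w = n \<Longrightarrow> homog n (mon w)" "homog n 0" "homog n x \<Longrightarrow> homog n y \<Longrightarrow> homog n (x - y)"
  "(\<And>i. i \<in> A \<Longrightarrow> homog n (f i)) \<Longrightarrow> homog n (sum f A)"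
  "gdeg g + gdeg h = n \<Longrightarrow> homog n (mon [g] * mon [h])"
proof -
  show "wdeg w = n \<Longrightarrow> homog n (mon w)" for w by (simp add: homog_def mon.rep_eq)
  from this[of "[g, h]"] show "gdeg g + gdeg h = n \<Longrightarrow> homog n (mon [g] * mon [h])"
    using mon_append[of "[g]" "[h]", where 'r = 'r] by simp
  show "homog n 0" by (simp add: homog_def zero_falg.rep_eq fzero_def)
  show "homog n x \<Longrightarrow> homog n y \<Longrightarrow> homog n (x - y)"
    unfolding homog_def minus_falg.rep_eq fsub_def by (metis diff_self)
  show "(\<And>i. i \<in> A \<Longrightarrow> homog n (f i)) \<Longrightarrow> homog n (sum f A)"
    unfolding homog_def coef_sum fsum_def by (metis (no_types, lifting) sum.neutral)
qed

lemma homc_homog: "homog d x \<Longrightarrow> homc n x = (if n = d then x else 0)"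
  by (rule coef_inject[THEN iffD1], rule ext)
     (auto simp: homog_def proj.rep_eq zero_falg.rep_eq fzero_def)

lemma rel_homog: "x \<in> rel \<Longrightarrow> \<exists>d. homog d x"
proof (induction rule: rel.induct)
  case (PP v w)
  show ?case by (intro exI[of _ 0] homog_intros) (auto intro!: homog_intros)
next
  case (SS l m)
  then show ?case
    by (intro exI[of _ "gdeg (Sg l) + gdeg (Sg m)"] homog_intros) (auto simp: fun_eq_iff)
next
  case (TT l m)
  then show ?case
    by (intro exI[of _ "gdeg (Tg l) + gdeg (Tg m)"] homog_intros) (auto simp: fun_eq_iff)
next
  case (TS n l m)
  then show ?case
    by (intro exI[of _ "gdeg (Tg l) + gdeg (Sg m)"] homog_intros) (auto intro!: homog_intros simp: fun_eq_iff)
next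
  case (ST v n)
  show ?case
    by (intro exI[of _ 0] homog_intros) (auto simp: fun_eq_iff)
qed (auto intro!: exI homog_intros simp: fun_eq_iff)

text \<open>The elements all of whose components lie in \<open>K\<close> form an ideal, and it
  contains the relations because these are homogeneous.\<close>

lemma homc_K: "x \<in> K \<Longrightarrow> homc n x \<in> K"
proof -
  let ?I = "{x. \<forall>n. homc n x \<in> K}"
  have "uideal ?I"
    unfolding uideal_def
  proof (intro conjI ballI allI)
    fix x a :: "('a, 'r) falg" assume x: "x \<in> ?I"
    show "a * x \<in> ?I"
      by (induction a rule: falg_induct)
         (use x in \<open>simp_all add: proj_linear distrib_right homc_mon_mult K_ideal(1-4)\<close>)
    show "x * a \<in> ?I"
      by (induction a rule: falg_induct)
         (use x in \<open>simp_all add: proj_linear distrib_left homc_mult_mon K_ideal(1-3) K_ideal(5)\<close>)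
  qed (auto simp: proj_linear intro: K_ideal)
  moreover have "rel \<subseteq> ?I"
  proof
    fix x assume "x \<in> rel"
    with rel_homog obtain d where "homog d x" by blast
    with rel_K[OF \<open>x \<in> rel\<close>] show "x \<in> ?I" by (simp add: homc_homog K_ideal)
  qed
  ultimately show "x \<in> K \<Longrightarrow> homc n x \<in> K" using K_least by blast
qed

lemma pspan_dd_KPhom:
  assumes "x \<in> pspan (dd n)" "coef x [] = 0" shows "coef x \<in> KPhom k G n"
proof -
  let ?e = "\<lambda>p. fmul (sp (fst p)) (sps (snd p)) :: ('a, 'r) fa"
  let ?X = "{fmul (sp a) (sps b) | a b. a \<in> paths G \<and> b \<in> paths G \<and>
        (\<lambda>i. int (deg G a i) - int (deg G b i)) = n} :: ('a, 'r) fa set"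
  from pspan_nf[OF assms(1)] obtain F c where F: "finite F"
    "F \<subseteq> {(a, b). a \<in> paths G \<and> b \<in> paths G \<and> src G a = src G b \<and> dd n a b}"
    "x \<approx> (\<Sum>p\<in>F. scl (c p) (S (fst p) * T (snd p)))"
    unfolding nf_def by blast
  have e: "?e p = coef (mon [Sg (fst p), Tg (snd p)])" for p
    using mon_append[of "[Sg (fst p)]" "[Tg (snd p)]", where 'r = 'r]
    by (simp add: coef_gen times_falg.rep_eq)
  \<comment> \<open>In \<open>fspan\<close> coefficients are indexed by algebra elements instead of
    pairs. Distinct pairs give distinct words in the free algebra, so \<open>c\<close> can be
    carried over by the inverse of \<open>?e\<close>.\<close>
  have "inj ?e"
  proof (rule injI)
    fix p q assume "?e p = ?e q"
    from fun_cong[OF this, of "[Sg (fst p), Tg (snd p)]"] show "p = q"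
      unfolding e by (auto simp: mon.rep_eq prod_eq_iff split: if_splits)
  qed
  then have inv: "inv ?e (?e p) = p" for p by (rule inv_f_f)
  let ?c = "\<lambda>y. c (inv ?e y)"
  have "coef (\<Sum>p\<in>F. scl (c p) (S (fst p) * T (snd p))) = fsum (\<lambda>p. fscale (c p) (?e p)) F"
    by (simp only: coef_sum scl.rep_eq times_falg.rep_eq coef_gen)
  also have "\<dots> = fsum (\<lambda>p. fscale (?c (?e p)) (?e p)) F"
    unfolding inv ..
  also have "\<dots> = fsum (\<lambda>y. fscale (?c y) y) (?e ` F)"
    unfolding fsum_def sum.reindex[OF inj_on_subset[OF \<open>inj ?e\<close> subset_UNIV]] comp_def ..
  also have "\<dots> \<in> fspan ?X"
  proof -
    have "?e ` F \<subseteq> ?X"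
    proof (rule image_subsetI)
      fix p assume "p \<in> F"
      with F(2) have "fst p \<in> paths G" "snd p \<in> paths G" "dd n (fst p) (snd p)" by auto
      then show "?e p \<in> ?X" by (intro CollectI exI conjI refl) (auto simp: fun_eq_iff)
    qed
    with F(1) show ?thesis
      unfolding fspan_def by (intro CollectI exI[of _ "?e ` F"] exI[of _ ?c] conjI refl finite_imageI)
  qed
  finally have "coef (\<Sum>p\<in>F. scl (c p) (S (fst p) * T (snd p))) \<in> fspan ?X" .
  moreover have "fsub (coef x) (coef (\<Sum>p\<in>F. scl (c p) (S (fst p) * T (snd p)))) \<in> KPker k G"
    using F(3) by (simp add: eqK_def K_def up_def minus_falg.rep_eq)
  ultimately show ?thesis unfolding KPhom_def using assms(2) by (auto simp: FA_iff)
qed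

subsection \<open>Graded basic ideals and annihilators\<close>

text \<open>Gradedness is expressed by \<open>homc\<close>, in a form that \<open>An J\<close> can
  be shown to satisfy again; the second annihilator then falls under the same lemmas.\<close>

definition good :: "('a, 'r) falg set \<Rightarrow> bool" where
  "good J \<longleftrightarrow> uideal J \<and> K \<subseteq> J \<and> (\<forall>x\<in>J. coef x [] = 0) \<and> (\<forall>x\<in>J. \<forall>n. homc n x \<in> J) \<and>
     (\<forall>c v. v \<in> verts G \<longrightarrow> c \<noteq> 0 \<longrightarrow> scl c (P v) \<in> J \<longrightarrow> P v \<in> J)"

lemma goodD:
  assumes "good J"
  shows good_ideal: "uideal J" and good_K: "K \<subseteq> J" and good_Nil: "x \<in> J \<Longrightarrow> coef x [] = 0"
    and good_homc: "x \<in> J \<Longrightarrow> homc n x \<in> J"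
    and good_basic: "v \<in> verts G \<Longrightarrow> c \<noteq> 0 \<Longrightarrow> scl c (P v) \<in> J \<Longrightarrow> P v \<in> J"
  using assms unfolding good_def by blast+

lemma good_up:
  assumes J: "kp_ideal k G J" and gr: "graded_ideal k G J" and b: "basic_ideal G J"
  shows "good (up J :: ('a, 'r) falg set)"
  unfolding good_def
proof (intro conjI ballI allI impI)
  show "uideal (up J)" using J uideal_up by (auto simp: kp_ideal_def)
  show "K \<subseteq> up J" using J by (auto simp: kp_ideal_def K_def up_def)
  show Nil: "coef x [] = 0" if "x \<in> up J" for x
    using J that by (auto simp: kp_ideal_def is_ideal_def up_def FA_iff[symmetric])
  show "P v \<in> up J" if "v \<in> verts G" "c \<noteq> 0" "scl c (P v) \<in> up J" for c v
    using b that unfolding basic_ideal_def up_def by (simp add: coef_gen scl.rep_eq) 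
  show "homc n x \<in> up J" if x: "x \<in> up J" for x n
  proof -
    \<comment> \<open>Inserting \<open>n\<close> covers components that vanish; the decomposition
      into word degrees is the one fed to \<open>graded_ideal\<close>.\<close>
    let ?N = "insert n (wdeg ` {w. coef x w \<noteq> 0})"
    have hom: "coef (homc m x) \<in> KPhom k G m" for m
      using Nil[OF x] by (intro pspan_dd_KPhom homc_pspan) (auto simp: proj.rep_eq)
    have "fsub (coef x) (fsum (\<lambda>m. coef (homc m x)) ?N) = coef (x - (\<Sum>m\<in>?N. homc m x))"
      by (simp only: coef_sum minus_falg.rep_eq)
    moreover have "(\<Sum>m\<in>?N. homc m x) = x" by (rule homc_sum) auto
    ultimately have "fsub (coef x) (fsum (\<lambda>m. coef (homc m x)) ?N) \<in> KPker k G"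
      using K_ideal(1) \<open>(\<Sum>m\<in>?N. homc m x) = x\<close> by (simp add: K_def up_def)
    then have "\<forall>m\<in>?N. coef (homc m x) \<in> J"
      using gr x hom unfolding graded_ideal_def up_def
      by (elim ballE[of _ _ "coef x"] allE[of _ ?N] allE[of _ "\<lambda>m. coef (homc m x)"]) auto
    then show ?thesis by (simp add: up_def)
  qed
qed

text \<open>\<open>HS\<close>, \<open>HB\<close>, \<open>An\<close> and \<open>IV\<close> are \<open>Hset\<close>, \<open>Hbar\<close>, \<open>ann\<close> and \<open>Igen\<close> transported along \<open>up\<close>.\<close>

definition HS :: "('a, 'r) falg set \<Rightarrow> 'a set" where "HS J = {v \<in> verts G. P v \<in> J}"
definition HB :: "('a, 'r) falg set \<Rightarrow> 'a set" where
  "HB J = {rng G l | l. l \<in> paths G \<and> src G l \<in> HS J}"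
definition An :: "('a, 'r) falg set \<Rightarrow> ('a, 'r) falg set" where
  "An J = {a. coef a [] = 0 \<and> (\<forall>x\<in>J. a * x \<in> K \<and> x * a \<in> K)}"
definition IV :: "'a set \<Rightarrow> ('a, 'r) falg set" where "IV V = up (Igen k G V)"

lemma HS_up: "HS (up J) = Hset G J"
  by (simp add: HS_def Hset_def up_def coef_gen)

lemma HB_up: "HB (up J) = Hbar G J"
  by (simp add: HB_def Hbar_def HS_up)

lemma An_up:
  assumes "J \<subseteq> FA" shows "up (ann k G J) = An (up J)"
proof -
  have "J \<subseteq> coef ` up J"
  proof
    fix f assume "f \<in> J"
    then obtain x where "f = coef x" using assms FA_coefE by blast
    with \<open>f \<in> J\<close> show "f \<in> coef ` up J" by (simp add: up_def)
  qed
  then have "J = coef ` up J" by (auto simp: up_def)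
  then have "(\<forall>f\<in>J. Q f) \<longleftrightarrow> (\<forall>x\<in>up J. Q (coef x))" for Q
    using ball_simps(9)[of coef "up J" Q] by simp
  then show ?thesis
    unfolding An_def ann_def up_def[of "Collect _"] by (simp add: FA_iff K_def up_def[of "KPker k G"] times_falg.rep_eq)
qed

lemma Igen_set_FA: "(KPker k G \<union> {pp v | v. v \<in> V} :: ('a, 'r) fa set) \<subseteq> FA"
proof -
  have "(pp v :: ('a, 'r) fa) \<in> FA" for v
    unfolding coef_gen FA_iff by (simp add: mon.rep_eq)
  then show ?thesis
    using is_ideal_gen_ideal(3)[OF KPrel_FA] by (auto simp: KPker_def)
qed

lemma IV_props:
  shows IV_ideal: "uideal (IV V)" and IV_K: "K \<subseteq> IV V" and IV_P: "v \<in> V \<Longrightarrow> P v \<in> IV V"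
    and Igen_FA: "(Igen k G V :: ('a, 'r) fa set) \<subseteq> FA"
    and IV_least: "uideal I \<Longrightarrow> K \<subseteq> I \<Longrightarrow> (\<And>v. v \<in> V \<Longrightarrow> P v \<in> I) \<Longrightarrow> IV V \<subseteq> I"
proof -
  note gen = is_ideal_gen_ideal[OF Igen_set_FA[of V]]
  show "uideal (IV V)" unfolding IV_def Igen_def by (intro uideal_up gen)
  show "K \<subseteq> IV V" using gen(2) unfolding IV_def Igen_def K_def up_def by auto
  show "v \<in> V \<Longrightarrow> P v \<in> IV V" using gen(2) unfolding IV_def Igen_def up_def by (auto simp: coef_gen)
  show "(Igen k G V :: ('a, 'r) fa set) \<subseteq> FA" using gen(3) unfolding Igen_def .
  show "uideal I \<Longrightarrow> K \<subseteq> I \<Longrightarrow> (\<And>v. v \<in> V \<Longrightarrow> P v \<in> I) \<Longrightarrow> IV V \<subseteq> I"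
    unfolding IV_def Igen_def
    by (rule up_gen_ideal_least[OF Igen_set_FA]) (auto simp: up_def K_def coef_gen coef_inject)
qed

lemma pspan_src_subset:
  assumes I: "uideal I" "K \<subseteq> I" and V: "\<And>v. v \<in> V \<Longrightarrow> P v \<in> I"
  shows "pspan (\<lambda>a b. src G a \<in> V) \<subseteq> I"
proof
  fix x assume "x \<in> pspan (\<lambda>a b. src G a \<in> V)"
  then show "x \<in> I"
  proof (induction rule: pspan.induct)
    case (pspan_ST a b c)
    have "S a * P (src G a) * T b \<in> I" using V pspan_ST by (intro uidealD[OF I(1)])
    with eqK_mem[OF I ST_mid[OF pspan_ST(1)]] have "S a * T b \<in> I" by blast
    then show ?case by (rule uidealD(3)[OF I(1)])
  qed (use I in \<open>auto intro: uidealD\<close>)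
qed

text \<open>Gradedness keeps \<open>T a * homc n x * S b\<close> in \<open>J\<close>, and basicness
  then turns \<open>scl c (P (src G a))\<close> with \<open>c \<noteq> 0\<close> into
  \<open>P (src G a)\<close>.\<close>

lemma good_pspan:
  assumes J: "good J" and x: "x \<in> J"
  shows "x \<in> pspan (\<lambda>a b. src G a \<in> HS J)"
proof -
  note I = uidealD[OF good_ideal[OF J]]
  have "homc n x \<in> pspan (\<lambda>a b. src G a \<in> HS J)" for n
  proof (rule pspan_restrict)
    show "homc n x \<in> pspan (dd n)" using good_Nil[OF J x] by (rule homc_pspan)
    fix a b c assume ab: "a \<in> paths G" "b \<in> paths G" "src G a = src G b"
      and e: "T a * homc n x * S b \<approx> scl c (P (src G a))"
    have "T a * homc n x * S b \<in> J" by (intro I good_homc J x)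
    with eqK_mem[OF good_ideal[OF J] good_K[OF J] e] have "scl c (P (src G a)) \<in> J" by blast
    then show "c = 0 \<or> src G a \<in> HS J"
      using good_basic[OF J, of "src G a" c] ab by (auto simp: HS_def)
  qed
  then have "(\<Sum>n\<in>wdeg ` {w. coef x w \<noteq> 0}. homc n x) \<in> pspan (\<lambda>a b. src G a \<in> HS J)"
    by (rule pspan_sum)
  then show ?thesis using homc_sum[of "wdeg ` {w. coef x w \<noteq> 0}" x] by simp
qed

lemma good_eq_IV:
  assumes "good J" shows "J = IV (HS J)"
proof
  have "pspan (\<lambda>a b. src G a \<in> HS J) \<subseteq> IV (HS J)" by (intro pspan_src_subset IV_ideal IV_K IV_P)
  with good_pspan[OF assms] show "J \<subseteq> IV (HS J)" by blast
  show "IV (HS J) \<subseteq> J"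
    using good_ideal[OF assms] good_K[OF assms] by (intro IV_least) (auto simp: HS_def)
qed

lemma uideal_An: "uideal J \<Longrightarrow> uideal (An J)"
  unfolding uideal_def[of "An J"]
proof (intro conjI ballI allI)
  assume J: "uideal J"
  note I = uidealD[OF J]
  show "0 \<in> An J" by (simp add: An_def zero_falg.rep_eq fzero_def K_ideal)
  fix x assume "x \<in> An J"
  then have x: "coef x [] = 0" "\<And>y. y \<in> J \<Longrightarrow> x * y \<in> K" "\<And>y. y \<in> J \<Longrightarrow> y * x \<in> K"
    by (auto simp: An_def)
  show "x + y \<in> An J" if "y \<in> An J" for y
    using x that by (auto simp: An_def plus_falg.rep_eq fadd_def distrib_left distrib_right intro: K_ideal)
  show "scl c x \<in> An J" for c
    using x by (auto simp: An_def scl.rep_eq fscale_def intro: K_ideal)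
  show "a * x \<in> An J" for a
  proof -
    have "y * (a * x) \<in> K" if "y \<in> J" for y using x(3)[OF I(5)[OF that]] by (simp add: mult.assoc)
    then show ?thesis using x by (auto simp: An_def times_falg.rep_eq fmul_def mult.assoc intro: K_ideal)
  qed
  show "x * a \<in> An J" for a
  proof -
    have "x * a * y \<in> K" if "y \<in> J" for y using x(2)[OF I(4)[OF that]] by (simp add: mult.assoc)
    moreover have "y * (x * a) \<in> K" if "y \<in> J" for y
      using K_ideal(5)[OF x(3)[OF that]] by (simp add: mult.assoc)
    ultimately show ?thesis using x(1) by (auto simp: An_def times_falg.rep_eq fmul_def)
  qed
qed

text \<open>In a spanning element \<open>S a * T b\<close> of \<open>J\<close> both
  \<open>rng G a\<close> and \<open>rng G b\<close> lie in \<open>HB J\<close>, since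
  \<open>a\<close> and \<open>b\<close> share their source; hence \<open>v\<close> differs from both
  and \<open>P v\<close> kills the element on either side.\<close>

lemma P_in_An:
  assumes J: "good J" and v: "v \<in> verts G - HB J"
  shows "P v \<in> An J"
proof -
  have "P v * x \<in> K \<and> x * P v \<in> K" if "x \<in> pspan (\<lambda>a b. src G a \<in> HS J)" for x
    using that
  proof (induction rule: pspan.induct)
    case (pspan_ST a b c)
    then have "rng G a \<in> HB J" "rng G b \<in> HB J" by (auto simp: HB_def)
    with v have "v \<noteq> rng G a" "v \<noteq> rng G b" by auto
    then have "P v * S a \<in> K" "T b * P v \<in> K" using pspan_ST P_S0 T_P0 by auto
    then have "scl c (P v * S a * T b) \<in> K" "scl c (S a * (T b * P v)) \<in> K"
      by (blast intro: K_ideal(3) K_ideal(4) K_ideal(5))+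
    then show ?case by (simp add: mult.assoc)
  qed (auto simp: distrib_left distrib_right intro: K_ideal)
  with good_pspan[OF J] show ?thesis by (auto simp: An_def mon.rep_eq)
qed

text \<open>A path \<open>l\<close> with range \<open>u\<close> and source in \<open>HS J\<close>
  gives \<open>S l \<in> J\<close>; multiplying \<open>scl c (P u) * S l\<close> by
  \<open>T l\<close> yields \<open>scl c (P (src G l))\<close>, which then lies in
  \<open>K\<close>.\<close>

lemma scl_P_in_An:
  assumes J: "uideal J" "K \<subseteq> J" and u: "u \<in> verts G" and c: "scl c (P u) \<in> An J" and "u \<in> HB J"
  shows "c = 0"
proof -
  from \<open>u \<in> HB J\<close> obtain l where l: "l \<in> paths G" "rng G l = u" "P (src G l) \<in> J"
    by (auto simp: HB_def HS_def)
  have "S l \<in> J"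
    using eqK_mem[OF J S_P[OF l(1)]] uidealD(4)[OF J(1) l(3)] by blast
  with c have "scl c (P u) * S l \<in> K" by (auto simp: An_def)
  then have "T l * (scl c (P u) * S l) \<in> K" by (rule K_ideal)
  moreover have "scl c (T l * (P u * S l)) \<approx> scl c (T l * S l)"
    using P_S[OF l(1)] l(2) by (intro eqK_scl eqK_mult2) simp
  then have "scl c (T l * (P u * S l)) \<approx> scl c (P (src G l))"
    using eqK_scl[OF T_S_self[OF l(1)]] eqK_trans by blast
  ultimately have "scl c (P (src G l)) \<in> K" using eqK_memK by simp
  then show ?thesis by (rule scl_P_in_K[OF _ path_simps(13)[OF l(1)]])
qed

text \<open>The annihilator is not yet known to be graded; but \<open>J\<close> contains the homogeneous element
  \<open>S (cmp G b l)\<close> whenever \<open>src G l \<in> HS J\<close>, and annihilating a homogeneous element can be tested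
  on homogeneous components.\<close>

lemma homc_An_pspan:
  assumes J: "uideal J" "K \<subseteq> J" and x: "x \<in> An J"
  shows "homc n x \<in> pspan (\<lambda>a b. src G a \<in> verts G - HB J)"
proof (rule pspan_restrict)
  show "homc n x \<in> pspan (dd n)" using x by (intro homc_pspan) (simp add: An_def)
  fix a b c assume ab: "a \<in> paths G" "b \<in> paths G" "src G a = src G b"
    and e: "T a * homc n x * S b \<approx> scl c (P (src G a))"
  have "c = 0" if "src G a \<in> HB J"
  proof -
    from that obtain l where l: "l \<in> paths G" "rng G l = src G a" "P (src G l) \<in> J"
      by (auto simp: HB_def HS_def)
    let ?bl = "cmp G b l"
    have bl: "?bl \<in> paths G" "src G ?bl = src G l" using ab l by simp_all
    have "S ?bl \<in> J"
      using eqK_mem[OF J S_P[OF bl(1)]] uidealD(4)[OF J(1) l(3)] bl(2) by simp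
    with x have "x * S ?bl \<in> K" by (auto simp: An_def)
    \<comment> \<open>Multiplication by the one-letter word \<open>S ?bl\<close> moves every
      component by the degree of that letter, so this component of the product is
      \<open>homc n x * S ?bl\<close>.\<close>
    from homc_K[OF this, of "n + gdeg (Sg ?bl)"] have "homc n x * S ?bl \<in> K"
      by (simp add: homc_mult_mon)
    moreover have "homc n x * (S b * S l) \<approx> homc n x * S ?bl"
      using ab l by (intro eqK_mult2 S_S) simp_all
    ultimately have "homc n x * (S b * S l) \<in> K" using eqK_memK by blast
    \<comment> \<open>The product of \<open>T l * T a\<close>, \<open>homc n x\<close> and
      \<open>S b * S l\<close> is evaluated twice: it lies in \<open>K\<close>, and by
      \<open>e\<close> it is \<open>scl c (P (src G l))\<close> modulo \<open>K\<close>.\<close>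
    then have "T l * T a * (homc n x * (S b * S l)) \<in> K" by (rule K_ideal)
    moreover have "T l * (T a * homc n x * S b) * S l \<approx> T l * scl c (P (src G a)) * S l"
      by (intro eqK_mult1 eqK_mult2 e)
    ultimately have "T l * scl c (P (src G a)) * S l \<in> K" using eqK_memK by (simp add: mult.assoc)
    moreover have "scl c (T l * (P (src G a) * S l)) \<approx> scl c (T l * S l)"
      using P_S[OF l(1)] l(2) by (intro eqK_scl eqK_mult2) simp
    then have "scl c (T l * (P (src G a) * S l)) \<approx> scl c (P (src G l))"
      using eqK_scl[OF T_S_self[OF l(1)]] eqK_trans by blast
    ultimately have "scl c (P (src G l)) \<in> K" using eqK_memK by (simp add: mult.assoc)
    then show ?thesis by (rule scl_P_in_K[OF _ path_simps(13)[OF l(1)]])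
  qed
  with ab show "c = 0 \<or> src G a \<in> verts G - HB J" by auto
qed

text \<open>Gradedness is obtained here: components of annihilating elements lie in the span of the
  \<open>S a * T b\<close> with source outside \<open>HB J\<close>, and by \<open>P_in_An\<close>
  this span annihilates \<open>J\<close>. Once \<open>An J\<close> is good,
  \<open>good_eq_IV\<close> names its generators.\<close>

lemma good_An:
  assumes J: "good J"
  shows An_eq: "An J = IV (verts G - HB J)" and An_good: "good (An J)"
    and HS_An: "HS (An J) = verts G - HB J"
proof -
  note I = good_ideal[OF J] good_K[OF J]
  have An: "uideal (An J)" "K \<subseteq> An J"
    by (rule uideal_An[OF I(1)]) (auto simp: An_def K_Nil intro: K_ideal)
  have sub: "pspan (\<lambda>a b. src G a \<in> verts G - HB J) \<subseteq> An J"
    by (intro pspan_src_subset An P_in_An J)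
  show H: "HS (An J) = verts G - HB J"
  proof
    show "HS (An J) \<subseteq> verts G - HB J"
      \<comment> \<open>With coefficient 1, a vertex of \<open>HB J\<close> in
        \<open>HS (An J)\<close> would force 1 = 0.\<close>
      using scl_P_in_An[OF I, of _ 1] by (auto simp: HS_def)
    show "verts G - HB J \<subseteq> HS (An J)" using P_in_An[OF J] by (auto simp: HS_def)
  qed
  show "good (An J)"
    unfolding good_def
  proof (intro conjI ballI allI impI An)
    show "coef x [] = 0" if "x \<in> An J" for x using that by (simp add: An_def)
    show "homc n x \<in> An J" if "x \<in> An J" for x n using homc_An_pspan[OF I that] sub by blast
    show "P v \<in> An J" if "v \<in> verts G" "c \<noteq> 0" "scl c (P v) \<in> An J" for c v
      using scl_P_in_An[OF I that(1,3)] that P_in_An[OF J, of v] by auto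
  qed
  from good_eq_IV[OF this] show "An J = IV (verts G - HB J)" by (simp add: H)
qed

lemma annihilators:
  assumes "kp_ideal k G J" "graded_ideal k G J" "basic_ideal G (J :: ('a, 'r) fa set)"
  shows "ann k G J = Igen k G (verts G - Hbar G J)"
    and "ann k G (ann k G J) = Igen k G {w \<in> verts G. Tset G w \<subseteq> Hbar G J}"
    and "ann k G (ann k G J) = J \<longleftrightarrow> Hset G J = {w \<in> verts G. Tset G w \<subseteq> Hbar G J}"
proof -
  let ?W = "{w \<in> verts G. Tset G w \<subseteq> Hbar G J}"
  have J: "good (up J)" using assms by (rule good_up)
  have FA: "J \<subseteq> FA" "\<And>I :: ('a, 'r) fa set. ann k G I \<subseteq> FA"
    using assms(1) by (auto simp: kp_ideal_def is_ideal_def ann_def)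
  have up1: "up (ann k G J) = An (up J)" and up2: "up (ann k G (ann k G J)) = An (An (up J))"
    using An_up FA by simp_all
  have "HB (An (up J)) = {rng G l | l. l \<in> paths G \<and> src G l \<in> verts G - Hbar G J}"
    unfolding HB_def[of "An (up J)"] HS_An[OF J] HB_up ..
  \<comment> \<open>A vertex avoids this set exactly if every path having it as range has its source
    in \<open>Hbar G J\<close>.\<close>
  then have "verts G - HB (An (up J)) = ?W"
    by (auto simp: Tset_def)
  with An_eq[OF An_good[OF J]] have AA: "An (An (up J)) = IV ?W" by simp
  with HS_An[OF An_good[OF J]] \<open>verts G - HB (An (up J)) = ?W\<close> have HAA: "HS (An (An (up J))) = ?W" by simp
  show "ann k G J = Igen k G (verts G - Hbar G J)"
    by (rule up_inject[OF FA(2) Igen_FA]) (simp add: up1 An_eq[OF J] HB_up flip: IV_def)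
  show AA': "ann k G (ann k G J) = Igen k G ?W"
    by (rule up_inject[OF FA(2) Igen_FA]) (simp add: up2 AA flip: IV_def)
  show "ann k G (ann k G J) = J \<longleftrightarrow> Hset G J = ?W"
  proof
    assume "ann k G (ann k G J) = J"
    then have "An (An (up J)) = up J" using up2 by simp
    then show "Hset G J = ?W" using HAA by (simp add: HS_up)
  next
    assume "Hset G J = ?W"
    \<comment> \<open>Both ideals are generated by the vertices they contain, so equality of the
      vertex sets suffices.\<close>
    then have "up J = An (An (up J))" using good_eq_IV[OF J] AA by (simp add: HS_up)
    then show "ann k G (ann k G J) = J" by (intro up_inject FA) (simp add: up2)
  qed
qed

end

theorem mainTheorem7:
  fixes k :: nat and G :: "'a kgraph" and J :: "('a, 'r::comm_ring_1) fa set"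
  assumes "is_kgraph k G" and "row_finite G" and "locally_convex k G"
    and "kp_ideal k G J" and "graded_ideal k G J" and "basic_ideal G J"
  shows "ann k G J = Igen k G (verts G - Hbar G J) \<and>
         ann k G (ann k G J) = Igen k G {w \<in> verts G. Tset G w \<subseteq> Hbar G J} \<and>
         ((ann k G (ann k G J) = J) \<longleftrightarrow> Hset G J = {w \<in> verts G. Tset G w \<subseteq> Hbar G J})"
proof -
  interpret kp_algebra k G "TYPE('r)"
    by unfold_locales (rule assms)+
  show ?thesis using annihilators[OF assms(4-6)] by blast
qed

end
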